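(* There exist absolute constants $a,b>0$ such that for every $n\ge 2$ and every isotropic convex body $K$ in $\mathbb{R}^n$, $$a\,L_K^{-1}\le \mathrm{as}(K)\le b\,L_K^{-1}\qquad\text{and}\qquad a\,L_K^{-2}\le \mathrm{as}(K\cap\xi^{\perp})\le b\,L_K^{-2}\ \text{ for all } \xi\in S^{n-1}.$$ In particular, there exist absolute constants $a',b'>0$ such that for every such $K$, $$a'\,L_K\,|K|^{\frac{1}{n}}\max_{\xi\in S^{n-1}}\mathrm{as}(K\cap\xi^{\perp})\le \mathrm{as}(K)\le b'\,L_K\,|K|^{\frac{1}{n}}\max_{\xi\in S^{n-1}}\mathrm{as}(K\cap\xi^{\perp}).$$
   Context: $|\cdot|$ denotes volume in the appropriate dimension (the $0$-dimensional volume of a point is $1$). A convex body in $\mathbb{R}^n$ is a compact convex set with non-empty interior; it is centered if its barycenter is at the origin. A centered convex body $K$ of volume $1$ in $\mathbb{R}^n$ is called isotropic if there is a constant $L_K>0$ (its isotropic constant) with $\int_K\langle x,\xi\rangle^2dx=L_K^2$ for every $\xi\in S^{n-1}$. Absolute constants do not depend on $n$ or $K$. The average section functional is $\mathrm{as}(K)=\int_{S^{n-1}}|K\cap\xi^\perp|\,d\sigma(\xi)$, where $\sigma$ is the rotationally invariant probability measure on $S^{n-1}$ and $\xi^\perp$ is the hyperplane through $0$ orthogonal to $\xi$; for a linear subspace $E$, $\mathrm{as}(K\cap E)=\int_{S^{n-1}\cap E}|K\cap E\cap\theta^\perp|\,d\sigma_E(\theta)$, where $\sigma_E$ is the rotationally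 invariant probability measure on $S^{n-1}\cap E$. *)

theory Defs
  imports "HOL-Analysis.Analysis"
begin

(* The constants in the theorem must not depend on the dimension, so the dimension n has to be
   a term, not a type. Vectors of R^n are the extensional functions on {..<n}; this makes
   R^n the space of the library's product measure and the topspace of its product topology
   over the index set {..<n}. *)

definition lebn :: "nat \<Rightarrow> (nat \<Rightarrow> real) measure" where
  "lebn n = (\<Pi>\<^sub>M i\<in>{..<n}. lborel)"

definition topn :: "nat \<Rightarrow> (nat \<Rightarrow> real) topology" where
  "topn n = product_topology (\<lambda>i. euclideanreal) {..<n}"

definition Rn :: "nat \<Rightarrow> (nat \<Rightarrow> real) set" where
  "Rn n = (\<Pi>\<^sub>E i\<in>{..<n}. UNIV)"

definition dotn :: "nat \<Rightarrow> (nat \<Rightarrow> real) \<Rightarrow> (nat \<Rightarrow> real) \<Rightarrow> real" where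
  "dotn n x y = (\<Sum>i<n. x i * y i)"

definition lincomb :: "nat \<Rightarrow> real \<Rightarrow> (nat \<Rightarrow> real) \<Rightarrow> real \<Rightarrow> (nat \<Rightarrow> real) \<Rightarrow> nat \<Rightarrow> real" where
  "lincomb n a x b y = (\<lambda>i\<in>{..<n}. a * x i + b * y i)"

definition perp :: "nat \<Rightarrow> (nat \<Rightarrow> real) \<Rightarrow> (nat \<Rightarrow> real) set" where
  "perp n \<xi> = {x \<in> Rn n. dotn n x \<xi> = 0}"

definition unit_sphere :: "nat \<Rightarrow> (nat \<Rightarrow> real) set \<Rightarrow> (nat \<Rightarrow> real) set" where
  "unit_sphere n E = {x \<in> E. dotn n x x = 1}"


(* us is an orthonormal basis of the linear subspace E of R^n; length us is then dim E. *)

definition orthonormal_basis :: "nat \<Rightarrow> (nat \<Rightarrow> real) list \<Rightarrow> (nat \<Rightarrow> real) set \<Rightarrow> bool" where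
  "orthonormal_basis n us E \<longleftrightarrow>
     set us \<subseteq> Rn n \<and>
     (\<forall>i<length us. \<forall>j<length us. dotn n (us ! i) (us ! j) = (if i = j then 1 else 0)) \<and>
     E = range (\<lambda>t. \<lambda>i\<in>{..<n}. \<Sum>j<length us. t j * (us ! j) i)"

(* (dim E)-dimensional volume of a subset A of the linear subspace E: Lebesgue measure in
   orthonormal coordinates. The value does not depend on the chosen basis. For E = {0} the
   basis is empty and lebn 0 is the unit mass at a point, so that {0} has volume 1. *)

definition subspace_vol :: "nat \<Rightarrow> (nat \<Rightarrow> real) set \<Rightarrow> (nat \<Rightarrow> real) set \<Rightarrow> ennreal" where
  "subspace_vol n E A =
     (let us = (SOME us. orthonormal_basis n us E); k = length us
      in emeasure (lebn k) {t \<in> Rn k. (\<lambda>i\<in>{..<n}. \<Sum>j<k. t j * (us ! j) i) \<in> A})"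

definition linear_isometry_on :: "nat \<Rightarrow> (nat \<Rightarrow> real) set \<Rightarrow> ((nat \<Rightarrow> real) \<Rightarrow> nat \<Rightarrow> real) \<Rightarrow> bool" where
  "linear_isometry_on n E T \<longleftrightarrow>
     T \<in> E \<rightarrow> E \<and>
     (\<forall>x\<in>E. \<forall>y\<in>E. \<forall>a b. T (lincomb n a x b y) = lincomb n a (T x) b (T y)) \<and>
     (\<forall>x\<in>E. \<forall>y\<in>E. dotn n (T x) (T y) = dotn n x y)"

(* Invariance is under the full orthogonal group of E. For dim E \<ge> 2 this is the same as
   invariance under SO(E); for dim E = 1 it is needed to single out the uniform
   measure on the two points of the sphere. *)

definition rotation_invariant_prob :: "nat \<Rightarrow> (nat \<Rightarrow> real) set \<Rightarrow> (nat \<Rightarrow> real) measure \<Rightarrow> bool" where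
  "rotation_invariant_prob n E \<sigma> \<longleftrightarrow>
     sets \<sigma> = sets (restrict_space (\<Pi>\<^sub>M i\<in>{..<n}. borel) (unit_sphere n E)) \<and>
     emeasure \<sigma> (space \<sigma>) = 1 \<and>
     (\<forall>T. linear_isometry_on n E T \<longrightarrow> distr \<sigma> \<sigma> T = \<sigma>)"

(* For dim E \<ge> 1 there is exactly one such measure. *)

definition sphere_measure :: "nat \<Rightarrow> (nat \<Rightarrow> real) set \<Rightarrow> (nat \<Rightarrow> real) measure" where
  "sphere_measure n E = (SOME \<sigma>. rotation_invariant_prob n E \<sigma>)"

(* as(K \<inter> E); the functional as(K) itself is the case E = Rn n. For a convex body K with 0 in
   its interior the integrand is continuous in \<theta>, so the nonnegative integral is its
   ordinary Lebesgue integral. *)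

definition avg_section :: "nat \<Rightarrow> (nat \<Rightarrow> real) set \<Rightarrow> (nat \<Rightarrow> real) set \<Rightarrow> ennreal" where
  "avg_section n E K =
     (\<integral>\<^sup>+ \<theta>. subspace_vol n (E \<inter> perp n \<theta>) (K \<inter> E \<inter> perp n \<theta>) \<partial>sphere_measure n E)"


definition convex_body :: "nat \<Rightarrow> (nat \<Rightarrow> real) set \<Rightarrow> bool" where
  "convex_body n K \<longleftrightarrow>
     compactin (topn n) K \<and>
     (\<forall>x\<in>K. \<forall>y\<in>K. \<forall>t\<in>{0..1}. lincomb n (1 - t) x t y \<in> K) \<and>
     topn n interior_of K \<noteq> {}"

definition barycenter :: "nat \<Rightarrow> (nat \<Rightarrow> real) set \<Rightarrow> nat \<Rightarrow> real" where
  "barycenter n K = (\<lambda>i\<in>{..<n}. (LINT x:K|lebn n. x i) / measure (lebn n) K)"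

definition centered :: "nat \<Rightarrow> (nat \<Rightarrow> real) set \<Rightarrow> bool" where
  "centered n K \<longleftrightarrow> barycenter n K = (\<lambda>i\<in>{..<n}. 0)"

definition is_isotropic_constant :: "nat \<Rightarrow> (nat \<Rightarrow> real) set \<Rightarrow> real \<Rightarrow> bool" where
  "is_isotropic_constant n K L \<longleftrightarrow>
     L > 0 \<and> (\<forall>\<xi>\<in>unit_sphere n (Rn n). (LINT x:K|lebn n. (dotn n x \<xi>)\<^sup>2) = L\<^sup>2)"

definition isotropic :: "nat \<Rightarrow> (nat \<Rightarrow> real) set \<Rightarrow> bool" where
  "isotropic n K \<longleftrightarrow>
     convex_body n K \<and> centered n K \<and> measure (lebn n) K = 1 \<and>
     (\<exists>L. is_isotropic_constant n K L)"

definition isotropic_constant :: "nat \<Rightarrow> (nat \<Rightarrow> real) set \<Rightarrow> real" where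
  "isotropic_constant n K = (THE L. is_isotropic_constant n K L)"

end

theory Submission
  imports Defs "HOL-Probability.Distributions"
begin

text \<open>The sections \<open>K \<inter> E\<close> with \<open>E\<close> of codimension \<open>m \<in> {1, 2}\<close> all have volume comparable to
  \<open>L\<close> to the power \<open>- m\<close>, so averaging over the sphere only needs that the rotation-invariant
  probability measure exists.

  In orthonormal coordinates adapted to \<open>E\<close>, the volume \<open>f z\<close> of the section of \<open>K\<close> parallel to \<open>E\<close>
  at \<open>z\<close> is a density on an \<open>m\<close>-dimensional space; it is log-concave by the Prekopa-Leindler inequality
  and has barycenter \<open>0\<close> and covariance \<open>L\<^sup>2\<close> times the identity. The lower bound on \<open>f 0\<close> is
  Jensen's inequality for \<open>ln f\<close> combined with the fact that Gaussians maximise the entropy. For the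
  upper bound, log-concavity along rays shows that the second moment of \<open>f\<close> in any direction is at
  most a constant times the squared width of the level set \<open>{x. f 0 / exp 1 \<le> f x}\<close>; this convex set
  therefore contains a segment (\<open>m = 1\<close>) or a triangle (\<open>m = 2\<close>) of volume at least a constant times
  the \<open>m\<close>-th power of \<open>L\<close>, while its volume is at most \<open>exp 1 / f 0\<close>.\<close>

section \<open>The Prekopa-Leindler inequality\<close>

text \<open>Only the codimension m is bounded, while the dimension of the sections grows with n.
  Hence n and the dimension of a section are terms, and the complementary directions are carried by
  a type, \<open>real\<close> or \<open>real ^ 2\<close>, in which convex sets are separated and
  triangle areas computed; the locale \<open>marginal\<close> joins the two worlds. Since K need not
  be symmetric, f need not be largest at 0, so both bounds compare f with its value at 0 and not
  with its maximum. Log-concavity is the form of Brunn's principle that forgets the dimension of the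
  sections, which is why the constants depend on m alone. Rotation invariance of Lebesgue measure is
  used twice: to cut K along an arbitrary orthonormal frame, and to build the invariant measure on
  the sphere. The comparison of as(K) with the maximum over hyperplanes follows by dividing the
  two-sided bounds, because K has volume 1.\<close>

lemma emeasure_lborel_eq_SUP_compact:
  fixes A :: "'a::euclidean_space set"
  assumes A: "A \<in> sets borel" "A \<noteq> {}"
  shows "emeasure lborel A = (SUP K\<in>{K. compact K \<and> K \<subseteq> A \<and> K \<noteq> {}}. emeasure lborel K)"
proof (rule antisym)
  show "emeasure lborel A \<le> (SUP K\<in>{K. compact K \<and> K \<subseteq> A \<and> K \<noteq> {}}. emeasure lborel K)"
    unfolding le_SUP_iff
  proof (intro allI impI)
    fix y assume y: "y < emeasure lborel A"
    then obtain z where z: "y < z" "z < emeasure lborel A" using dense by blast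
    then obtain p q where pq: "y = ennreal p" "0 \<le> p" "z = ennreal q" "0 \<le> q"
      by (cases y; cases z) auto
    \<comment> \<open>The gap between \<open>y\<close> and \<open>z\<close> is the loss that the
      closed approximation may afford.\<close>
    define e where "e = q - p"
    have e: "0 < e" and ez: "y + ennreal e = z"
      using z(1) pq by (auto simp: e_def ennreal_less_iff ennreal_plus[symmetric] simp del: ennreal_plus)
    obtain T where T: "closed T" "T \<subseteq> A" "emeasure lebesgue (A - T) < ennreal e"
      using sets_lebesgue_inner_closed[of A e] A e by (metis sets_completionI_sets sets_lborel)
    have Tb: "T \<in> sets borel" using T by simp
    have "emeasure lborel (A - T) < ennreal e" using T(3) A Tb by simp
    moreover have "emeasure lborel A \<le> emeasure lborel T + emeasure lborel (A - T)"
      using A Tb T by (subst plus_emeasure) (auto simp: Un_absorb1)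
    ultimately have "emeasure lborel A \<le> emeasure lborel T + ennreal e"
      by (meson add_left_mono less_imp_le order_trans)
    moreover have "y + ennreal e < emeasure lborel A" using z ez by simp
    ultimately have "y + ennreal e < emeasure lborel T + ennreal e"
      by (meson less_le_trans)
    then have "y < emeasure lborel T" by (meson add_right_mono not_le)
    also have "emeasure lborel T = (SUP n::nat. emeasure lborel (T \<inter> cball 0 (real n)))"
    proof -
      have "(\<Union>n::nat. T \<inter> cball 0 (real n)) = T"
        using real_arch_simple by (auto simp: dist_norm)
      moreover have "(SUP n::nat. emeasure lborel (T \<inter> cball 0 (real n))) = emeasure lborel (\<Union>n::nat. T \<inter> cball 0 (real n))"
        using Tb by (intro SUP_emeasure_incseq) (auto simp: incseq_def)
      ultimately show ?thesis by simp
    qed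
    finally obtain n :: nat where n: "y < emeasure lborel (T \<inter> cball 0 (real n))"
      by (auto simp: less_SUP_iff)
    then have "T \<inter> cball 0 (real n) \<noteq> {}" by (metis emeasure_empty not_less_zero)
    with n T show "\<exists>K\<in>{K. compact K \<and> K \<subseteq> A \<and> K \<noteq> {}}. y < emeasure lborel K"
      by (intro bexI[of _ "T \<inter> cball 0 (real n)"]) (auto intro: closed_Int_compact)
  qed
  show "(SUP K\<in>{K. compact K \<and> K \<subseteq> A \<and> K \<noteq> {}}. emeasure lborel K) \<le> emeasure lborel A"
    using A by (intro SUP_least emeasure_mono) auto
qed

lemma emeasure_lborel_vimage_plus:
  fixes A :: "'a::euclidean_space set"
  assumes A: "A \<in> sets borel"
  shows "emeasure lborel ((+) c -` A) = emeasure lborel A"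
  using emeasure_distr[of "(+) c" "lborel :: 'a measure" borel A] A by (simp add: lborel_distr_plus)

lemma emeasure_lborel_translation:
  fixes A :: "'a::euclidean_space set"
  assumes A: "A \<in> sets borel"
  shows "emeasure lborel ((+) c ` A) = emeasure lborel A"
proof -
  have "(+) c ` A = (+) (- c) -` A" by (auto simp: image_iff intro!: bexI[of _ "_ - c"])
  then show ?thesis using emeasure_lborel_vimage_plus[OF A] by simp
qed

text \<open>For compact sets, add the minimum of the second to the first set and the maximum of the
  first to the second: both translates lie in \<open>C\<close> and meet in one point only. A
  superset \<open>C\<close> stands in for the sumset, which need not be Borel.\<close>

lemma brunn_minkowski_real:
  fixes A B C :: "real set"
  assumes A: "A \<in> sets borel" "A \<noteq> {}" and B: "B \<in> sets borel" "B \<noteq> {}" and C: "C \<in> sets borel"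
    and sub: "\<And>x y. x \<in> A \<Longrightarrow> y \<in> B \<Longrightarrow> x + y \<in> C"
  shows "emeasure lborel A + emeasure lborel B \<le> emeasure lborel C"
proof -
  have compact: "emeasure lborel K + emeasure lborel M \<le> emeasure lborel C"
    if K: "compact K" "K \<subseteq> A" "K \<noteq> {}" and M: "compact M" "M \<subseteq> B" "M \<noteq> {}" for K M
  proof -
    obtain k where k: "k \<in> K" "\<And>x. x \<in> K \<Longrightarrow> x \<le> k" using compact_attains_sup[OF K(1,3)] by blast
    obtain m where m: "m \<in> M" "\<And>x. x \<in> M \<Longrightarrow> m \<le> x" using compact_attains_inf[OF M(1,3)] by blast
    have cp: "compact ((+) m ` K)" "compact ((+) k ` M)"
      using K M by (auto intro: compact_translation)
    have "emeasure lborel K + emeasure lborel M = emeasure lborel ((+) m ` K) + emeasure lborel ((+) k ` M)"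
      using K M by (simp add: emeasure_lborel_translation borel_compact)
    \<comment> \<open>Removing the single common point \<open>k + m\<close> makes the two translates
      disjoint.\<close>
    also have "\<dots> = emeasure lborel ((+) m ` K) + emeasure lborel ((+) k ` M - {k + m})"
      using cp by (subst emeasure_Diff_null_set) (auto simp: borel_compact intro!: finite_imp_null_set_lborel)
    also have "\<dots> = emeasure lborel ((+) m ` K \<union> ((+) k ` M - {k + m}))"
      using cp k(2) m(2) by (intro plus_emeasure) (auto simp: borel_compact intro!: antisym, fastforce)
    also have "\<dots> \<le> emeasure lborel C"
      using k(1) m(1) K(2) M(2) C sub by (intro emeasure_mono) (auto simp: add.commute[of m] subset_iff)
    finally show ?thesis .
  qed
  \<comment> \<open>A constant can be moved into a supremum only over a nonempty index set; the
    empty supremum is 0.\<close>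
  have ne: "{K. compact K \<and> K \<subseteq> X \<and> K \<noteq> {}} \<noteq> {}" if "X \<noteq> {}" for X :: "real set"
    using that by (auto intro!: exI[of _ "{SOME x. x \<in> X}"] some_in_eq[THEN iffD2])
  show ?thesis
    unfolding emeasure_lborel_eq_SUP_compact[OF A] emeasure_lborel_eq_SUP_compact[OF B]
    unfolding ennreal_SUP_add_left[OF ne[OF A(2)], symmetric] ennreal_SUP_add_right[OF ne[OF B(2)]]
    using compact by (intro SUP_least) auto
qed

section \<open>Layer-cake integration and Prekopa-Leindler on the line\<close>

text \<open>Layer-cake formula with levels written as fractions \<open>l\<close> of the cap
  \<open>a\<close>, so that functions with different caps can be compared at the same
  \<open>l\<close>.\<close>

lemma nn_integral_min_layers:
  fixes f :: "real \<Rightarrow> ennreal"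
  assumes [measurable]: "f \<in> borel_measurable borel" and a: "0 < a"
  shows "(\<integral>\<^sup>+ x. min (f x) (ennreal a) \<partial>lborel)
    = ennreal a * (\<integral>\<^sup>+ l. indicator {0<..<1} l * emeasure lborel {x. ennreal (l * a) < f x} \<partial>lborel)"
proof -
  \<comment> \<open>For fixed \<open>x\<close>, the set of fractions \<open>l\<close> with
    \<open>l * a < f x\<close> is an interval starting at 0; the lemma is then Fubini.\<close>
  have layer: "(\<integral>\<^sup>+ l. indicator {0<..<1} l * indicator {x. ennreal (l * a) < f x} x \<partial>lborel) = min (f x / ennreal a) 1"
    for x
  proof (cases "ennreal a \<le> f x")
    case True
    have "(\<integral>\<^sup>+ l. indicator {0<..<1} l * indicator {x. ennreal (l * a) < f x} x \<partial>lborel)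
        = (\<integral>\<^sup>+ l. indicator {0<..<1::real} l \<partial>lborel)"
    proof (intro nn_integral_cong)
      fix l :: real
      have "ennreal (l * a) < f x" if "0 < l" "l < 1"
        using True that a by (intro less_le_trans[OF _ True]) (auto simp: ennreal_less_iff)
      then show "indicator {0<..<1} l * indicator {x. ennreal (l * a) < f x} x = (indicator {0<..<1} l :: ennreal)"
        by (auto simp: indicator_def)
    qed
    also have "\<dots> = 1" by simp
    moreover have "1 \<le> f x / ennreal a"
      using divide_right_mono_ennreal[OF True, of "ennreal a"] a by simp
    ultimately show ?thesis by (simp add: min_absorb2)
  next
    case False
    then have lt: "f x < ennreal a" by simp
    then obtain r where r: "f x = ennreal r" "0 \<le> r" by (cases "f x") auto
    then have ra: "r < a" using lt by (simp add: ennreal_less_iff)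
    have "(\<integral>\<^sup>+ l. indicator {0<..<1} l * indicator {x. ennreal (l * a) < f x} x \<partial>lborel)
        = (\<integral>\<^sup>+ l. indicator {0<..<r/a} l \<partial>lborel)"
    proof (intro nn_integral_cong)
      fix l :: real
      show "indicator {0<..<1} l * indicator {x. ennreal (l * a) < f x} x = (indicator {0<..<r/a} l :: ennreal)"
        using ra r a less_trans[of l "r/a" 1] by (auto simp: indicator_def ennreal_less_iff field_simps)
    qed
    also have "\<dots> = ennreal (r / a)" using r a by simp
    also have "\<dots> = f x / ennreal a" using r a by (simp add: divide_ennreal)
    also have "\<dots> = min (f x / ennreal a) 1"
      using r a ra by (simp add: divide_ennreal min_def ennreal_le_1)
    finally show ?thesis .
  qed
  have "(\<integral>\<^sup>+ l. indicator {0<..<1} l * emeasure lborel {x. ennreal (l * a) < f x} \<partial>lborel)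
      = (\<integral>\<^sup>+ l. (\<integral>\<^sup>+ x. indicator {0<..<1} l * indicator {x. ennreal (l * a) < f x} x \<partial>lborel) \<partial>lborel)"
    by (subst nn_integral_cmult) auto
  also have "\<dots> = (\<integral>\<^sup>+ x. (\<integral>\<^sup>+ l. indicator {0<..<1} l * indicator {x. ennreal (l * a) < f x} x \<partial>lborel) \<partial>lborel)"
    by (rule lborel_pair.Fubini') measurable
  also have "\<dots> = (\<integral>\<^sup>+ x. min (f x / ennreal a) 1 \<partial>lborel)" by (simp only: layer)
  also have "ennreal a * \<dots> = (\<integral>\<^sup>+ x. ennreal a * min (f x / ennreal a) 1 \<partial>lborel)"
    by (subst nn_integral_cmult) auto
  also have "\<dots> = (\<integral>\<^sup>+ x. min (f x) (ennreal a) \<partial>lborel)"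
  proof (intro nn_integral_cong)
    fix x
    have "ennreal a * min (f x / ennreal a) 1 = min (ennreal a * (f x / ennreal a)) (ennreal a * 1)"
      by (metis min_def mult_left_mono mult_right_mono nle_le zero_le)
    also have "ennreal a * (f x / ennreal a) = f x"
      using a by (simp add: ennreal_times_divide mult.commute[of "ennreal a"] ennreal_mult_divide_eq)
    finally show "ennreal a * min (f x / ennreal a) 1 = min (f x) (ennreal a)" by simp
  qed
  finally show ?thesis by simp
qed

text \<open>The level \<open>a\<close> replaces the supremum of \<open>f\<close>, which may be infinite.\<close>

lemma exists_truncation:
  fixes f :: "real \<Rightarrow> ennreal"
  assumes [measurable]: "f \<in> borel_measurable borel" and c: "c < integral\<^sup>N lborel f"
  obtains a where "0 < a" "ennreal a \<le> (SUP x. f x)" "c < (\<integral>\<^sup>+ x. min (f x) (ennreal a) \<partial>lborel)"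
proof -
  have sup: "(SUP n::nat. min y (of_nat n)) = y" for y :: ennreal
  proof (rule antisym)
    show "y \<le> (SUP n::nat. min y (of_nat n))"
      unfolding le_SUP_iff
    proof (intro allI impI)
      fix z assume "z < y"
      moreover from this obtain n :: nat where "z < of_nat n"
        using ennreal_Ex_less_of_nat[of z] by (meson less_le_trans top_greatest)
      ultimately show "\<exists>n\<in>UNIV. z < min y (of_nat n)" by auto
    qed
  qed (auto intro: SUP_least)
  have "integral\<^sup>N lborel f = (\<integral>\<^sup>+ x. (SUP n::nat. min (f x) (of_nat n)) \<partial>lborel)" by (simp only: sup)
  also have "\<dots> = (SUP n::nat. \<integral>\<^sup>+ x. min (f x) (of_nat n) \<partial>lborel)"
  proof (rule nn_integral_monotone_convergence_SUP)
    show "incseq (\<lambda>(n::nat) x. min (f x) (of_nat n))"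
      by (auto simp: incseq_def le_fun_def min.coboundedI2 le_infI2 intro!: min.mono)
  qed simp
  finally obtain n :: nat where n: "c < (\<integral>\<^sup>+ x. min (f x) (of_nat n) \<partial>lborel)"
    using c by (auto simp: less_SUP_iff)
  \<comment> \<open>Capping at the supremum of \<open>f\<close> leaves the truncation unchanged and
    ensures that every level strictly below the cap is exceeded somewhere, as the nonempty level
    sets in \<open>brunn_minkowski_real\<close> require.\<close>
  define e where "e = min (of_nat n) (SUP x. f x)"
  have "e \<le> of_nat n" by (simp add: e_def)
  then have "e \<noteq> top" using of_nat_less_top[of n] by auto
  then obtain a where a: "e = ennreal a" "0 \<le> a" by (cases e) auto
  have "(\<integral>\<^sup>+ x. min (f x) (of_nat n) \<partial>lborel) = (\<integral>\<^sup>+ x. min (f x) (ennreal a) \<partial>lborel)"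
  proof (intro nn_integral_cong)
    fix x
    have "min (f x) (SUP x. f x) = f x" by (intro min_absorb1 SUP_upper) simp
    then show "min (f x) (of_nat n) = min (f x) (ennreal a)"
      unfolding a(1)[symmetric] e_def min.left_commute[of "f x" "of_nat n"] by (simp only: min.commute)
  qed
  with n have 1: "c < (\<integral>\<^sup>+ x. min (f x) (ennreal a) \<partial>lborel)" by simp
  have "a \<noteq> 0" using 1 by auto
  with a 1 show ?thesis by (intro that[of a]) (auto simp: a(1)[symmetric] e_def)
qed

text \<open>Since \<open>powr\<close> is not defined on \<^typ>\<open>ennreal\<close>, the hypothesis that \<open>h\<close> dominates the
  weighted geometric mean of \<open>f\<close> and \<open>g\<close> is expressed through real lower bounds of \<open>f\<close> and \<open>g\<close>,
  and so is the conclusion.\<close>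

lemma prekopa_leindler_real:
  fixes f g h :: "real \<Rightarrow> ennreal"
  assumes [measurable]: "f \<in> borel_measurable borel" "g \<in> borel_measurable borel" "h \<in> borel_measurable borel"
    and t: "0 < t" "t < 1"
    and le: "\<And>x y c d. 0 < c \<Longrightarrow> 0 < d \<Longrightarrow> ennreal c < f x \<Longrightarrow> ennreal d < g y \<Longrightarrow>
      ennreal (c powr (1 - t) * d powr t) \<le> h ((1 - t) * x + t * y)"
    and c: "0 < c" "ennreal c < integral\<^sup>N lborel f" and d: "0 < d" "ennreal d < integral\<^sup>N lborel g"
  shows "ennreal (c powr (1 - t) * d powr t) \<le> integral\<^sup>N lborel h"
proof -
  obtain a where a: "0 < a" "ennreal a \<le> (SUP x. f x)" "ennreal c < (\<integral>\<^sup>+ x. min (f x) (ennreal a) \<partial>lborel)"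
    using exists_truncation[OF _ c(2)] by auto
  obtain b where b: "0 < b" "ennreal b \<le> (SUP x. g x)" "ennreal d < (\<integral>\<^sup>+ x. min (g x) (ennreal b) \<partial>lborel)"
    using exists_truncation[OF _ d(2)] by auto
  \<comment> \<open>Chosen so that the weighted geometric mean of the levels \<open>l * a\<close>
    and \<open>l * b\<close> is \<open>l * m\<close>.\<close>
  define m where "m = a powr (1 - t) * b powr t"
  have m: "0 < m" using a b by (simp add: m_def)
  \<comment> \<open>The level sets of \<open>f'\<close> and \<open>g'\<close> are those of
    \<open>f\<close> and \<open>g\<close> dilated by \<open>1 - t\<close> and \<open>t\<close>,
    which turns convex combinations into plain sums.\<close>
  define f' where "f' x = f (x / (1 - t))" for x
  define g' where "g' x = g (x / t)" for x
  have f'[measurable]: "f' \<in> borel_measurable borel" and g'[measurable]: "g' \<in> borel_measurable borel"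
    by (auto simp: f'_def[abs_def] g'_def[abs_def])
  have level: "emeasure lborel {x. ennreal (l * a) < f' x} + emeasure lborel {x. ennreal (l * b) < g' x}
      \<le> emeasure lborel {x. ennreal (l * m) < h x}" if l: "0 < l" "l < 1" for l
  proof (rule brunn_minkowski_real)
    have "ennreal (l * a) < ennreal a" using l a by (simp add: ennreal_less_iff)
    then obtain x where "ennreal (l * a) < f x" using a(2) by (metis less_SUP_iff less_le_trans)
    then show "{x. ennreal (l * a) < f' x} \<noteq> {}" using t by (auto simp: f'_def intro!: exI[of _ "x * (1 - t)"])
    have "ennreal (l * b) < ennreal b" using l b by (simp add: ennreal_less_iff)
    then obtain x where "ennreal (l * b) < g x" using b(2) by (metis less_SUP_iff less_le_trans)
    then show "{x. ennreal (l * b) < g' x} \<noteq> {}" using t by (auto simp: g'_def intro!: exI[of _ "x * t"])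
    fix x y assume xy: "x \<in> {x. ennreal (l * a) < f' x}" "y \<in> {x. ennreal (l * b) < g' x}"
    \<comment> \<open>The hypothesis yields only a weak inequality for \<open>h\<close>. A value
      strictly between \<open>l * a\<close> and \<open>f' x\<close> makes it strict, as membership
      in the level set of \<open>h\<close> demands.\<close>
    obtain z where z: "ennreal (l * a) < z" "z < f' x" using xy dense by auto
    then obtain r where r: "z = ennreal r" "0 \<le> r" by (cases z) auto
    have lr: "l * a < r" using z l a by (simp add: r ennreal_less_iff)
    then have r0: "0 < r" using l a by (meson less_trans mult_pos_pos)
    have la: "0 < l * a" "0 < l * b" using l a b by auto
    have "l * m = (l powr (1 - t) * l powr t) * m" using l by (simp add: powr_add[symmetric])
    also have "\<dots> = (l * a) powr (1 - t) * (l * b) powr t"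
      using l a b by (simp add: m_def powr_mult)
    also have "\<dots> < r powr (1 - t) * (l * b) powr t"
      using lr la t by (intro mult_strict_right_mono powr_less_mono2) auto
    finally have lm: "l * m < r powr (1 - t) * (l * b) powr t" .
    then have "ennreal (l * m) < ennreal (r powr (1 - t) * (l * b) powr t)"
      using l m by (simp add: ennreal_less_iff)
    also have "\<dots> \<le> h ((1 - t) * (x / (1 - t)) + t * (y / t))"
      using xy z r0 la by (intro le) (auto simp: f'_def g'_def r)
    also have "(1 - t) * (x / (1 - t)) + t * (y / t) = x + y" using t by simp
    finally show "x + y \<in> {x. ennreal (l * m) < h x}" by simp
  qed measurable
  have mins: "(\<integral>\<^sup>+ x. min (f' x) (ennreal a) \<partial>lborel) = ennreal (1 - t) * (\<integral>\<^sup>+ x. min (f x) (ennreal a) \<partial>lborel)"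
    "(\<integral>\<^sup>+ x. min (g' x) (ennreal b) \<partial>lborel) = ennreal t * (\<integral>\<^sup>+ x. min (g x) (ennreal b) \<partial>lborel)"
    using t nn_integral_real_affine[where c="1 - t" and t=0 and f="\<lambda>x. min (f' x) (ennreal a)"]
        nn_integral_real_affine[where c="t" and t=0 and f="\<lambda>x. min (g' x) (ennreal b)"]
    by (auto simp: f'_def g'_def)
  define I where "I = (\<integral>\<^sup>+ l. indicator {0<..<1} l * emeasure lborel {x. ennreal (l * a) < f' x} \<partial>lborel)"
  define J where "J = (\<integral>\<^sup>+ l. indicator {0<..<1} l * emeasure lborel {x. ennreal (l * b) < g' x} \<partial>lborel)"
  have "ennreal ((1 - t) * c) \<le> ennreal a * I"
    unfolding I_def nn_integral_min_layers[OF f' a(1), symmetric] mins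
    using a t c by (auto simp: ennreal_mult intro!: mult_left_mono)
  then have I: "ennreal ((1 - t) * (c / a)) \<le> I"
    using a t c by (cases I) (auto simp: ennreal_mult[symmetric] field_simps)
  have "ennreal (t * d) \<le> ennreal b * J"
    unfolding J_def nn_integral_min_layers[OF g' b(1), symmetric] mins
    using b t d by (auto simp: ennreal_mult intro!: mult_left_mono)
  then have J: "ennreal (t * (d / b)) \<le> J"
    using b t d by (cases J) (auto simp: ennreal_mult[symmetric] field_simps)
  have meas[measurable]: "(\<lambda>l. emeasure lborel {x. ennreal (l * k) < u x}) \<in> borel_measurable borel"
    if [measurable]: "u \<in> borel_measurable borel" for u :: "real \<Rightarrow> ennreal" and k
  proof -
    have "(\<lambda>l. \<integral>\<^sup>+ x. indicator {x. ennreal (l * k) < u x} x \<partial>lborel) \<in> borel_measurable borel"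
      by measurable
    then show ?thesis by simp
  qed
  \<comment> \<open>After division by the caps, the geometric mean is at most the arithmetic mean,
    and the latter is additive like the bound in \<open>level\<close>.\<close>
  have "c powr (1 - t) * d powr t = m * ((c / a) powr (1 - t) * (d / b) powr t)"
    using a b c d by (simp add: m_def powr_divide)
  also have "\<dots> \<le> m * ((1 - t) * (c / a) + t * (d / b))"
    using a b c d t m by (intro mult_left_mono Youngs_inequality_0) auto
  finally have "ennreal (c powr (1 - t) * d powr t) \<le> ennreal (m * ((1 - t) * (c / a) + t * (d / b)))"
    by (rule ennreal_leI)
  also have "\<dots> = ennreal m * (ennreal ((1 - t) * (c / a)) + ennreal (t * (d / b)))"
    using a b c d t m by (simp add: ennreal_mult ennreal_plus[symmetric] del: ennreal_plus)
  also have "\<dots> \<le> ennreal m * (I + J)" by (intro mult_left_mono add_mono I J) simp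
  also have "I + J = (\<integral>\<^sup>+ l. indicator {0<..<1} l * (emeasure lborel {x. ennreal (l * a) < f' x}
      + emeasure lborel {x. ennreal (l * b) < g' x}) \<partial>lborel)"
    unfolding I_def J_def by (subst nn_integral_add[symmetric]) (auto simp: distrib_left)
  also have "\<dots> \<le> (\<integral>\<^sup>+ l. indicator {0<..<1} l * emeasure lborel {x. ennreal (l * m) < h x} \<partial>lborel)"
    by (intro nn_integral_mono) (auto simp: indicator_def level)
  also have "ennreal m * \<dots> = (\<integral>\<^sup>+ x. min (h x) (ennreal m) \<partial>lborel)"
    using m by (simp add: nn_integral_min_layers)
  also have "\<dots> \<le> integral\<^sup>N lborel h" by (intro nn_integral_mono) auto
  finally show ?thesis by (simp add: mult_left_mono)
qed

section \<open>Prekopa-Leindler in all dimensions\<close>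

lemma nn_integral_lebn_Suc:
  assumes f: "f \<in> borel_measurable (lebn (Suc k))"
  shows "integral\<^sup>N (lebn (Suc k)) f = (\<integral>\<^sup>+ s. (\<integral>\<^sup>+ x. f (x(k := s)) \<partial>lebn k) \<partial>lborel)"
proof -
  interpret product_sigma_finite "\<lambda>_::nat. lborel :: real measure" ..
  show ?thesis
    using f unfolding lebn_def lessThan_Suc by (intro product_nn_integral_insert_rev) auto
qed

lemma sigma_finite_lebn: "sigma_finite_measure (lebn k)"
proof -
  interpret product_sigma_finite "\<lambda>_::nat. lborel :: real measure" ..
  show ?thesis unfolding lebn_def by (rule sigma_finite) simp
qed

lemma measurable_fun_upd_lebn: "(\<lambda>(s, x). x(k := s)) \<in> lborel \<Otimes>\<^sub>M lebn k \<rightarrow>\<^sub>M lebn (Suc k)"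
  unfolding lebn_def lessThan_Suc by measurable

text \<open>Induction on the dimension: fix the last coordinate and integrate over the others. The
  induction hypothesis says that these partial integrals satisfy the assumption of the
  one-dimensional inequality.\<close>

theorem prekopa_leindler:
  fixes f g h :: "(nat \<Rightarrow> real) \<Rightarrow> ennreal"
  assumes "f \<in> borel_measurable (lebn k)" "g \<in> borel_measurable (lebn k)" "h \<in> borel_measurable (lebn k)"
    and t: "0 < t" "t < 1"
    and "\<And>x y c d. x \<in> Rn k \<Longrightarrow> y \<in> Rn k \<Longrightarrow> 0 < c \<Longrightarrow> 0 < d \<Longrightarrow> ennreal c < f x \<Longrightarrow> ennreal d < g y \<Longrightarrow>
      ennreal (c powr (1 - t) * d powr t) \<le> h (lincomb k (1 - t) x t y)"
    and "0 < c" "ennreal c < integral\<^sup>N (lebn k) f" "0 < d" "ennreal d < integral\<^sup>N (lebn k) g"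
  shows "ennreal (c powr (1 - t) * d powr t) \<le> integral\<^sup>N (lebn k) h"
  using assms(1-3,6-)
proof (induction k arbitrary: f g h c d)
  case 0
  interpret product_sigma_finite "\<lambda>_::nat. lborel :: real measure" ..
  \<comment> \<open>\<open>lebn 0\<close> is the unit mass at the only extensional function on the
    empty index set, which is \<open>undefined\<close> everywhere.\<close>
  have int: "integral\<^sup>N (lebn 0) u = u (\<lambda>k. undefined)" for u :: "(nat \<Rightarrow> real) \<Rightarrow> ennreal"
    unfolding lebn_def lessThan_0 by (rule nn_integral_empty) simp
  have "lincomb 0 (1 - t) (\<lambda>k. undefined) t (\<lambda>k. undefined) = (\<lambda>k. undefined)"
    by (simp add: lincomb_def fun_eq_iff)
  with 0(4)[of "\<lambda>k. undefined" "\<lambda>k. undefined" c d] 0(5-) show ?case by (simp add: int Rn_def)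
next
  case (Suc k)
  note [measurable] = Suc.prems(1-3) measurable_fun_upd_lebn
  interpret sigma_finite_measure "lebn k" by (rule sigma_finite_lebn)
  have upd: "x(k := s) \<in> Rn (Suc k)" if "x \<in> Rn k" for x s
    using that by (auto simp: Rn_def PiE_def extensional_def)
  have [measurable]: "(\<lambda>x. x(k := s)) \<in> lebn k \<rightarrow>\<^sub>M lebn (Suc k)" for s
    by (rule measurable_compose[OF _ measurable_fun_upd_lebn, where f="\<lambda>x. (s, x)", simplified]) simp
  have meas: "(\<lambda>s. \<integral>\<^sup>+ x. u (x(k := s)) \<partial>lebn k) \<in> borel_measurable borel"
    if [measurable]: "u \<in> borel_measurable (lebn (Suc k))" for u :: "(nat \<Rightarrow> real) \<Rightarrow> ennreal"
  proof -
    have "(\<lambda>(s, x). u (x(k := s))) \<in> borel_measurable (lborel \<Otimes>\<^sub>M lebn k)"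
      using measurable_compose[OF measurable_fun_upd_lebn that] by (simp add: case_prod_unfold)
    from borel_measurable_nn_integral[OF this] show ?thesis by simp
  qed
  have "ennreal (c powr (1 - t) * d powr t) \<le> (\<integral>\<^sup>+ s. (\<integral>\<^sup>+ x. h (x(k := s)) \<partial>lebn k) \<partial>lborel)"
  proof (rule prekopa_leindler_real[OF meas meas meas t])
    fix s s' c d :: real
    assume cd: "0 < c" "0 < d" "ennreal c < (\<integral>\<^sup>+ x. f (x(k := s)) \<partial>lebn k)"
      "ennreal d < (\<integral>\<^sup>+ x. g (x(k := s')) \<partial>lebn k)"
    show "ennreal (c powr (1 - t) * d powr t) \<le> (\<integral>\<^sup>+ x. h (x(k := (1 - t) * s + t * s')) \<partial>lebn k)"
    proof (rule Suc.IH[OF _ _ _ _ cd(1,3,2,4)])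
      fix x y c d assume xy: "x \<in> Rn k" "y \<in> Rn k" "0 < c" "0 < d"
        "ennreal c < f (x(k := s))" "ennreal d < g (y(k := s'))"
      have eq: "lincomb (Suc k) (1 - t) (x(k := s)) t (y(k := s'))
          = (lincomb k (1 - t) x t y)(k := (1 - t) * s + t * s')"
        by (auto simp: lincomb_def fun_eq_iff restrict_def)
      show "ennreal (c powr (1 - t) * d powr t) \<le> h ((lincomb k (1 - t) x t y)(k := (1 - t) * s + t * s'))"
        using Suc.prems(4)[OF upd[OF xy(1)] upd[OF xy(2)] xy(3-6)] unfolding eq .
    qed measurable
  qed (use Suc.prems(1-3,5-) in \<open>simp_all only: nn_integral_lebn_Suc\<close>)
  then show ?case using Suc.prems by (simp add: nn_integral_lebn_Suc)
qed


section \<open>Orthonormal coordinates\<close>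

text \<open>The spanning condition of \<open>orthonormal_basis\<close> is left out, so that systems
  can be grown one vector at a time.\<close>

definition orthonormal :: "nat \<Rightarrow> (nat \<Rightarrow> real) list \<Rightarrow> bool" where
  "orthonormal n us \<longleftrightarrow> set us \<subseteq> Rn n \<and>
     (\<forall>i<length us. \<forall>j<length us. dotn n (us ! i) (us ! j) = (if i = j then 1 else 0))"

definition comb :: "nat \<Rightarrow> (nat \<Rightarrow> real) list \<Rightarrow> (nat \<Rightarrow> real) \<Rightarrow> nat \<Rightarrow> real" where
  "comb n us t = (\<lambda>i\<in>{..<n}. \<Sum>j<length us. t j * (us ! j) i)"

definition coords :: "nat \<Rightarrow> (nat \<Rightarrow> real) list \<Rightarrow> (nat \<Rightarrow> real) \<Rightarrow> nat \<Rightarrow> real" where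
  "coords n us x = (\<lambda>j\<in>{..<length us}. dotn n x (us ! j))"

definition linear_subspace :: "nat \<Rightarrow> (nat \<Rightarrow> real) set \<Rightarrow> bool" where
  "linear_subspace n E \<longleftrightarrow> E \<subseteq> Rn n \<and> (\<lambda>i\<in>{..<n}. 0) \<in> E \<and>
     (\<forall>x\<in>E. \<forall>y\<in>E. \<forall>a b. lincomb n a x b y \<in> E)"

lemma orthonormal_basis_iff:
  "orthonormal_basis n us E \<longleftrightarrow> orthonormal n us \<and> E = range (comb n us)"
  by (simp add: orthonormal_basis_def orthonormal_def comb_def[abs_def])

lemma Rn_eqI: "x \<in> Rn n \<Longrightarrow> y \<in> Rn n \<Longrightarrow> (\<And>i. i < n \<Longrightarrow> x i = y i) \<Longrightarrow> x = y"
  unfolding Rn_def by (rule PiE_ext) auto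

lemma Rn_simps [simp]:
  "comb n us t \<in> Rn n" "coords n us x \<in> Rn (length us)" "lincomb n a x b y \<in> Rn n"
  "(\<lambda>i\<in>{..<n}. f i) \<in> Rn n"
  by (auto simp: comb_def coords_def lincomb_def Rn_def)

lemma space_lebn: "space (lebn n) = Rn n"
  by (simp add: lebn_def Rn_def space_PiM)

lemma dotn_commute: "dotn n x y = dotn n y x"
  by (simp add: dotn_def mult.commute)

lemma dotn_nonneg: "0 \<le> dotn n x x"
  by (simp add: dotn_def sum_nonneg)

lemma dotn_lincomb_left: "dotn n (lincomb n a x b y) z = a * dotn n x z + b * dotn n y z"
  by (simp add: dotn_def lincomb_def sum_distrib_left sum.distrib[symmetric] algebra_simps)

lemma dotn_lincomb_right: "dotn n z (lincomb n a x b y) = a * dotn n z x + b * dotn n z y"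
  by (simp add: dotn_commute[of n z] dotn_lincomb_left)

lemma dotn_comb_left: "dotn n (comb n us t) x = (\<Sum>j<length us. t j * dotn n (us ! j) x)"
proof -
  have "dotn n (comb n us t) x = (\<Sum>i<n. \<Sum>j<length us. t j * (us ! j) i * x i)"
    by (simp add: dotn_def comb_def sum_distrib_right)
  also have "\<dots> = (\<Sum>j<length us. \<Sum>i<n. t j * (us ! j) i * x i)" by (rule sum.swap)
  finally show ?thesis by (simp add: dotn_def sum_distrib_left mult.assoc)
qed

lemma dotn_eq_0_iff: "x \<in> Rn n \<Longrightarrow> dotn n x x = 0 \<longleftrightarrow> x = (\<lambda>i\<in>{..<n}. 0)"
  by (auto simp: dotn_def sum_nonneg_eq_0_iff intro!: Rn_eqI[of _ n])

lemma dotn_unit: "i < n \<Longrightarrow> dotn n (\<lambda>k\<in>{..<n}. if k = i then 1 else 0) x = x i"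
  by (simp add: dotn_def if_distrib[where f="\<lambda>c. c * _"] cong: if_cong)

context
  fixes n us assumes us: "orthonormal n us"
begin

lemma orthonormal_nth: "j < length us \<Longrightarrow> us ! j \<in> Rn n"
  using us by (auto simp: orthonormal_def)

lemma orthonormal_dotn:
  "i < length us \<Longrightarrow> j < length us \<Longrightarrow> dotn n (us ! i) (us ! j) = (if i = j then 1 else 0)"
  using us by (auto simp: orthonormal_def)

lemma dotn_comb_nth: "j < length us \<Longrightarrow> dotn n (comb n us t) (us ! j) = t j"
  by (simp add: dotn_comb_left orthonormal_dotn if_distrib cong: if_cong)

lemma dotn_comb_comb: "dotn n (comb n us s) (comb n us t) = dotn (length us) s t"
  by (simp add: dotn_comb_left[of n us s] dotn_commute[of n "us ! _"] dotn_comb_nth dotn_def[of "length us"])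

text \<open>Pythagoras for the orthogonal projection of \<open>x\<close> onto the span of
  \<open>us\<close>; Bessel's inequality is its nonnegativity.\<close>

lemma dotn_residual:
  "dotn n (lincomb n 1 x (-1) (comb n us (coords n us x))) (lincomb n 1 x (-1) (comb n us (coords n us x)))
    = dotn n x x - dotn (length us) (coords n us x) (coords n us x)"
proof -
  have "dotn n (comb n us (coords n us x)) x = dotn (length us) (coords n us x) (coords n us x)"
    by (subst dotn_comb_left) (simp add: dotn_def[of "length us"] coords_def dotn_commute[of n x])
  moreover from this have "dotn n x (comb n us (coords n us x)) = dotn (length us) (coords n us x) (coords n us x)"
    by (simp only: dotn_commute[of n x])
  ultimately show ?thesis
    by (simp add: dotn_lincomb_left dotn_lincomb_right dotn_comb_comb)
qed

lemma bessel: "dotn (length us) (coords n us x) (coords n us x) \<le> dotn n x x"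
  using dotn_residual[of x] dotn_nonneg[of n "lincomb n 1 x (-1) (comb n us (coords n us x))"] by simp

text \<open>Both sides are the trace of the orthogonal projection onto the span of
  \<open>us\<close>. Comparing the summands with 1 gives all the dimension counts below.\<close>

lemma sum_norm_coords_unit:
  "(\<Sum>i<n. dotn (length us) (coords n us (\<lambda>k\<in>{..<n}. if k = i then 1 else 0))
      (coords n us (\<lambda>k\<in>{..<n}. if k = i then 1 else 0))) = length us"
proof -
  have "(\<Sum>i<n. dotn (length us) (coords n us (\<lambda>k\<in>{..<n}. if k = i then 1 else 0))
      (coords n us (\<lambda>k\<in>{..<n}. if k = i then 1 else 0))) = (\<Sum>i<n. \<Sum>j<length us. (us ! j) i * (us ! j) i)"
    by (intro sum.cong refl) (simp add: dotn_def[of "length us"] coords_def dotn_unit)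
  also have "\<dots> = (\<Sum>j<length us. dotn n (us ! j) (us ! j))"
    by (subst sum.swap) (simp add: dotn_def)
  also have "\<dots> = length us" by (simp add: orthonormal_dotn)
  finally show ?thesis .
qed

lemma length_orthonormal_le: "length us \<le> n"
proof -
  have "real (length us) \<le> (\<Sum>i<n. 1)"
    unfolding sum_norm_coords_unit[symmetric]
    by (intro sum_mono order_trans[OF bessel]) (simp add: dotn_unit)
  then show ?thesis by simp
qed

lemma comb_in_subspace:
  assumes E: "linear_subspace n E" "set us \<subseteq> E"
  shows "comb n us t \<in> E"
proof -
  have "(\<lambda>i\<in>{..<n}. \<Sum>j<k. t j * (us ! j) i) \<in> E" if "k \<le> length us" for k
    using that
  proof (induction k)
    case 0 then show ?case using E by (simp only: linear_subspace_def lessThan_0 sum.empty)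
  next
    case (Suc k)
    have "(\<lambda>i\<in>{..<n}. \<Sum>j<Suc k. t j * (us ! j) i)
        = lincomb n 1 (\<lambda>i\<in>{..<n}. \<Sum>j<k. t j * (us ! j) i) (t k) (us ! k)"
      by (auto simp: lincomb_def)
    moreover have "us ! k \<in> E" using Suc.prems E by auto
    ultimately show ?case
      using Suc.IH Suc.prems E(1) by (metis (no_types, lifting) Suc_leD linear_subspace_def)
  qed
  then show ?thesis by (simp add: comb_def)
qed

text \<open>One Gram-Schmidt step: normalise the residual of \<open>x\<close>, which is nonzero
  because \<open>x\<close> is outside the span.\<close>

lemma orthonormal_extend:
  assumes E: "linear_subspace n E" "set us \<subseteq> E" and x: "x \<in> E" "x \<noteq> comb n us (coords n us x)"
  obtains u where "u \<in> E" "orthonormal n (us @ [u])"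
proof -
  define w where "w = lincomb n 1 x (-1) (comb n us (coords n us x))"
  have xR: "x \<in> Rn n" using E x by (auto simp: linear_subspace_def)
  have w: "w \<in> E" using E x comb_in_subspace[OF E] by (auto simp: linear_subspace_def w_def)
  have "dotn n w w \<noteq> 0"
  proof
    assume "dotn n w w = 0"
    then have "w = (\<lambda>i\<in>{..<n}. 0)" by (subst (asm) dotn_eq_0_iff) (auto simp: w_def)
    then have "w i = 0" if "i < n" for i using that by simp
    then have "x = comb n us (coords n us x)"
      by (intro Rn_eqI[OF xR]) (auto simp: w_def lincomb_def)
    with x show False by simp
  qed
  then have pos: "0 < dotn n w w" using dotn_nonneg[of n w] by simp
  define u where "u = lincomb n (1 / sqrt (dotn n w w)) w 0 w"
  have u: "u \<in> E" using E w by (auto simp: linear_subspace_def u_def)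
  have uu: "dotn n u u = 1"
    using pos by (simp add: u_def dotn_lincomb_left dotn_lincomb_right)
  have "dotn n w (us ! j) = 0" if "j < length us" for j
    using that by (simp add: w_def dotn_lincomb_left dotn_comb_nth) (simp add: coords_def)
  then have orth: "dotn n u (us ! j) = 0" if "j < length us" for j
    using that by (simp add: u_def dotn_lincomb_left)
  moreover have "dotn n (us ! j) u = 0" if "j < length us" for j
    using orth[OF that] by (simp only: dotn_commute)
  moreover have "u \<in> Rn n" by (simp add: u_def)
  ultimately have "orthonormal n (us @ [u])"
    using us uu by (auto simp: orthonormal_def nth_append less_Suc_eq)
  with u show ?thesis by (rule that)
qed

end

lemma linear_subspace_Rn: "linear_subspace n (Rn n)"
  by (auto simp: linear_subspace_def)

lemma linear_subspace_Int_perp: "linear_subspace n E \<Longrightarrow> linear_subspace n (E \<inter> perp n v)"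
  by (auto simp: linear_subspace_def perp_def dotn_lincomb_left) (simp add: dotn_def)

lemma perp_eq: "perp n v = Rn n \<inter> perp n v"
  by (auto simp: perp_def)

text \<open>An orthonormal system in \<open>E\<close> of greatest length must span, since otherwise
  a Gram-Schmidt step would lengthen it. A greatest length exists because lengths are at most
  \<open>n\<close>.\<close>

lemma exists_orthonormal_basis:
  assumes E: "linear_subspace n E"
  obtains us where "orthonormal_basis n us E"
proof -
  define P where "P l \<longleftrightarrow> (\<exists>us. orthonormal n us \<and> set us \<subseteq> E \<and> length us = l)" for l
  have P0: "P 0" by (auto simp: orthonormal_def P_def)
  have bound: "l \<le> n" if "P l" for l
    using that length_orthonormal_le unfolding P_def by blast
  define l where "l = (GREATEST l. P l)"
  have "P l" unfolding l_def by (rule GreatestI_nat[of P, OF P0 bound])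
  have l: "m \<le> l" if "P m" for m
    unfolding l_def by (rule Greatest_le_nat[of P, OF that bound])
  from \<open>P l\<close> obtain us where us: "orthonormal n us" "set us \<subseteq> E" "length us = l" unfolding P_def by blast
  have "x = comb n us (coords n us x)" if x: "x \<in> E" for x
  proof (rule ccontr)
    assume "x \<noteq> comb n us (coords n us x)"
    then obtain u where "u \<in> E" "orthonormal n (us @ [u])"
      by (rule orthonormal_extend[OF us(1) E us(2) x])
    with us have "P (Suc l)" unfolding P_def by (intro exI[of _ "us @ [u]"]) auto
    with l[of "Suc l"] show False by simp
  qed
  then have "E = range (comb n us)" using comb_in_subspace[OF us(1) E us(2)] by auto
  with us that show ?thesis by (simp add: orthonormal_basis_iff)
qed

lemma comb_coords:
  assumes "orthonormal_basis n us E" "x \<in> E"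
  shows "comb n us (coords n us x) = x"
proof -
  from assms obtain t where us: "orthonormal n us" and t: "x = comb n us t"
    by (auto simp: orthonormal_basis_iff)
  have "coords n us x j = t j" if "j < length us" for j
    using that dotn_comb_nth[OF us] by (simp add: coords_def t)
  then show ?thesis by (auto simp: t comb_def fun_eq_iff restrict_def intro!: sum.cong)
qed

text \<open>If the system spans, Bessel is an equality on the unit vectors and the trace is
  \<open>n\<close>. Conversely, a system of \<open>n\<close> vectors cannot be extended, so it
  spans.\<close>

lemma orthonormal_basis_Rn_iff:
  "orthonormal_basis n us (Rn n) \<longleftrightarrow> orthonormal n us \<and> length us = n"
proof (intro iffI conjI)
  assume us: "orthonormal_basis n us (Rn n)"
  then show "orthonormal n us" by (simp add: orthonormal_basis_iff)
next
  assume us: "orthonormal_basis n us (Rn n)"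
  then have o: "orthonormal n us" by (simp add: orthonormal_basis_iff)
  have "dotn (length us) (coords n us x) (coords n us x) = dotn n x x" if "x \<in> Rn n" for x
    using dotn_comb_comb[OF o, of "coords n us x" "coords n us x"] comb_coords[OF us that] by simp
  then have "(\<Sum>i<n. 1) = real (length us)"
    unfolding sum_norm_coords_unit[OF o, symmetric] by (intro sum.cong refl) (simp add: dotn_unit)
  then show "length us = n" by simp
next
  assume us: "orthonormal n us \<and> length us = n"
  have "x \<in> range (comb n us)" if x: "x \<in> Rn n" for x
  proof (rule ccontr)
    assume "x \<notin> range (comb n us)"
    then have ne: "x \<noteq> comb n us (coords n us x)" by auto
    have "set us \<subseteq> Rn n" using us by (simp add: orthonormal_def)
    then obtain u where "orthonormal n (us @ [u])"
      using orthonormal_extend[OF conjunct1[OF us] linear_subspace_Rn _ x ne] by blast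
    from length_orthonormal_le[OF this] us show False by simp
  qed
  then have "Rn n = range (comb n us)" by auto
  with us show "orthonormal_basis n us (Rn n)" by (simp add: orthonormal_basis_iff)
qed

text \<open>Subtracting the component along \<open>v\<close> splits \<open>E\<close> into
  \<open>E \<inter> perp n v\<close> and the line of \<open>v\<close>. The new vector goes last
  because \<open>marginal\<close> reads the first coordinates as those of the section.\<close>

lemma orthonormal_basis_append:
  assumes E: "linear_subspace n E" and us: "orthonormal_basis n us (E \<inter> perp n v)"
    and v: "v \<in> unit_sphere n E"
  shows "orthonormal_basis n (us @ [v]) E"
proof -
  have o: "orthonormal n us" using us by (simp add: orthonormal_basis_iff)
  have vE: "v \<in> E" "dotn n v v = 1" "v \<in> Rn n" using v E by (auto simp: unit_sphere_def linear_subspace_def)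
  have sub: "us ! j \<in> E \<inter> perp n v" if "j < length us" for j
  proof -
    have "comb n us (\<lambda>i. if i = j then 1 else 0) = us ! j"
      using that orthonormal_nth[OF o that]
      by (intro Rn_eqI[of _ n]) (auto simp: comb_def if_distrib[where f="\<lambda>c. c * _"] cong: if_cong)
    then show ?thesis using us by (metis orthonormal_basis_iff rangeI)
  qed
  have orth: "dotn n (us ! j) v = 0" if "j < length us" for j
    using sub[OF that] by (simp add: perp_def)
  moreover have "dotn n v (us ! j) = 0" if "j < length us" for j
    using orth[OF that] by (simp only: dotn_commute)
  ultimately have on: "orthonormal n (us @ [v])"
    using o vE by (auto simp: orthonormal_def nth_append less_Suc_eq)
  have subE: "set (us @ [v]) \<subseteq> E"
    using sub vE by (auto simp: in_set_conv_nth)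
  have "x \<in> range (comb n (us @ [v]))" if x: "x \<in> E" for x
  proof -
    define y where "y = lincomb n 1 x (- dotn n x v) v"
    have "y \<in> E \<inter> perp n v"
      using x vE E by (auto simp: y_def linear_subspace_def perp_def dotn_lincomb_left)
    then obtain t where t: "y = comb n us t" using us by (auto simp: orthonormal_basis_iff)
    have "x = comb n (us @ [v]) (t(length us := dotn n x v))"
    proof (rule Rn_eqI)
      fix i assume i: "i < n"
      have "x i = y i + dotn n x v * v i" using i by (simp add: y_def lincomb_def)
      then show "x i = comb n (us @ [v]) (t(length us := dotn n x v)) i"
        using i by (simp add: t comb_def nth_append)
    qed (use x E in \<open>auto simp: linear_subspace_def\<close>)
    then show ?thesis by blast
  qed
  then have "E = range (comb n (us @ [v]))"
    using comb_in_subspace[OF on E subE] by auto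
  with on show ?thesis by (simp add: orthonormal_basis_iff)
qed

section \<open>Measurability; Lebesgue measure under translations and orthogonal maps\<close>

lemma measurable_lebnI:
  assumes "\<And>i. i < n \<Longrightarrow> (\<lambda>x. f x i) \<in> borel_measurable M" "\<And>x. x \<in> space M \<Longrightarrow> f x \<in> Rn n"
  shows "f \<in> M \<rightarrow>\<^sub>M lebn n"
  unfolding lebn_def using assms by (intro measurable_PiM_single') (auto simp: Rn_def)

lemma measurable_component_lebn: "i < n \<Longrightarrow> (\<lambda>x. x i) \<in> borel_measurable (lebn n)"
  unfolding lebn_def using measurable_component_singleton[of i "{..<n}" "\<lambda>_. lborel"] by simp

lemma measurable_lebnD: "f \<in> M \<rightarrow>\<^sub>M lebn n \<Longrightarrow> i < n \<Longrightarrow> (\<lambda>x. f x i) \<in> borel_measurable M"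
  by (rule measurable_compose[OF _ measurable_component_lebn])

lemma measurable_dotn [measurable]:
  assumes "f \<in> M \<rightarrow>\<^sub>M lebn n" "g \<in> M \<rightarrow>\<^sub>M lebn n"
  shows "(\<lambda>x. dotn n (f x) (g x)) \<in> borel_measurable M"
  unfolding dotn_def using assms
  by (intro borel_measurable_sum borel_measurable_times measurable_lebnD[of _ M] borel_measurable_const) auto

lemma measurable_lincomb [measurable]:
  assumes "f \<in> M \<rightarrow>\<^sub>M lebn n" "g \<in> M \<rightarrow>\<^sub>M lebn n"
  shows "(\<lambda>x. lincomb n a (f x) b (g x)) \<in> M \<rightarrow>\<^sub>M lebn n"
proof (rule measurable_lebnI)
  fix i assume i: "i < n"
  have "(\<lambda>x. a * f x i + b * g x i) \<in> borel_measurable M"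
    using assms i
    by (intro borel_measurable_add borel_measurable_times measurable_lebnD[of _ M] borel_measurable_const) auto
  then show "(\<lambda>x. lincomb n a (f x) b (g x) i) \<in> borel_measurable M" using i by (simp add: lincomb_def)
qed simp

lemma measurable_comb [measurable]:
  assumes "f \<in> M \<rightarrow>\<^sub>M lebn (length us)"
  shows "(\<lambda>x. comb n us (f x)) \<in> M \<rightarrow>\<^sub>M lebn n"
proof (rule measurable_lebnI)
  fix i assume i: "i < n"
  have "(\<lambda>x. \<Sum>j<length us. f x j * (us ! j) i) \<in> borel_measurable M"
    using assms
    by (intro borel_measurable_sum borel_measurable_times measurable_lebnD[of _ M] borel_measurable_const) auto
  then show "(\<lambda>x. comb n us (f x) i) \<in> borel_measurable M" using i by (simp add: comb_def)
qed simp

lemma measurable_coords [measurable]: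
  assumes f: "f \<in> M \<rightarrow>\<^sub>M lebn n" and us: "set us \<subseteq> Rn n"
  shows "(\<lambda>x. coords n us (f x)) \<in> M \<rightarrow>\<^sub>M lebn (length us)"
proof (rule measurable_lebnI)
  fix j assume j: "j < length us"
  have "us ! j \<in> space (lebn n)" using us j by (auto simp: space_lebn)
  then have "(\<lambda>x. dotn n (f x) (us ! j)) \<in> borel_measurable M"
    using f by (intro measurable_dotn) auto
  then show "(\<lambda>x. coords n us (f x) j) \<in> borel_measurable M" using j by (simp add: coords_def)
qed simp

lemma distr_lebn_translation:
  assumes y: "y \<in> Rn n"
  shows "distr (lebn n) (lebn n) (\<lambda>x. lincomb n 1 x 1 y) = lebn n"
proof -
  interpret product_sigma_finite "\<lambda>_::nat. lborel :: real measure" ..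
  have ys: "y \<in> space (lebn n)" using y by (simp add: space_lebn)
  show ?thesis
    unfolding lebn_def
  proof (rule PiM_eqI)
    fix A :: "nat \<Rightarrow> real set" assume A: "\<And>i. i \<in> {..<n} \<Longrightarrow> A i \<in> sets lborel"
    have "emeasure (distr (lebn n) (lebn n) (\<lambda>x. lincomb n 1 x 1 y)) (Pi\<^sub>E {..<n} A)
        = emeasure (lebn n) ((\<lambda>x. lincomb n 1 x 1 y) -` (Pi\<^sub>E {..<n} A) \<inter> space (lebn n))"
      using A ys by (intro emeasure_distr measurable_lincomb) (auto simp: lebn_def intro!: sets_PiM_I_finite)
    also have "(\<lambda>x. lincomb n 1 x 1 y) -` (Pi\<^sub>E {..<n} A) \<inter> space (lebn n) = Pi\<^sub>E {..<n} (\<lambda>i. (+) (y i) -` A i)"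
      by (auto simp: space_lebn Rn_def lincomb_def PiE_iff add.commute)
    also have "emeasure (lebn n) \<dots> = (\<Prod>i\<in>{..<n}. emeasure lborel ((+) (y i) -` A i))"
      unfolding lebn_def
    proof (rule emeasure_PiM)
      fix i assume "i \<in> {..<n}"
      then have "A i \<in> sets borel" using A by simp
      then show "(+) (y i) -` A i \<in> sets lborel"
        using measurable_sets_borel[of "(+) (y i)" borel "A i"] by simp
    qed simp
    also have "\<dots> = (\<Prod>i\<in>{..<n}. emeasure lborel (A i))"
      using A by (intro prod.cong refl emeasure_lborel_vimage_plus) auto
    finally show "emeasure (distr (Pi\<^sub>M {..<n} (\<lambda>i. lborel)) (Pi\<^sub>M {..<n} (\<lambda>i. lborel)) (\<lambda>x. lincomb n 1 x 1 y)) (Pi\<^sub>E {..<n} A)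
        = (\<Prod>i\<in>{..<n}. emeasure lborel (A i))" by (simp add: lebn_def)
  qed simp_all
qed

lemma nn_integral_lebn_translation:
  assumes f: "f \<in> borel_measurable (lebn n)" and y: "y \<in> Rn n"
  shows "(\<integral>\<^sup>+ x. f (lincomb n 1 x 1 y) \<partial>lebn n) = integral\<^sup>N (lebn n) f"
proof -
  have "y \<in> space (lebn n)" using y by (simp add: space_lebn)
  then have "(\<integral>\<^sup>+ x. f (lincomb n 1 x 1 y) \<partial>lebn n) = integral\<^sup>N (distr (lebn n) (lebn n) (\<lambda>x. lincomb n 1 x 1 y)) f"
    using f by (subst nn_integral_distr) auto
  then show ?thesis using y by (simp add: distr_lebn_translation)
qed

lemma emeasure_lebn_box:
  "emeasure (lebn n) (Pi\<^sub>E {..<n} (\<lambda>i. {a<..<b})) = ennreal (max 0 (b - a)) ^ n"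
proof -
  interpret product_sigma_finite "\<lambda>_::nat. lborel :: real measure" ..
  have "emeasure lborel {a<..<b} = ennreal (max 0 (b - a))"
    by (cases "a \<le> b") (auto simp: max_def)
  then show ?thesis unfolding lebn_def by (subst emeasure_PiM) simp_all
qed

text \<open>The origin is excluded because this set will be projected radially onto the
  sphere.\<close>

lemma punctured_ball_measurable [measurable]: "{t \<in> Rn n. 0 < dotn n t t \<and> dotn n t t < 1} \<in> sets (lebn n)"
  unfolding space_lebn[symmetric] by measurable

lemma ball_measurable [measurable]: "{t \<in> Rn n. dotn n t t < 1} \<in> sets (lebn n)"
  unfolding space_lebn[symmetric] by measurable

lemma emeasure_ball_finite: "emeasure (lebn n) {t \<in> Rn n. dotn n t t < 1} < \<infinity>"
proof -
  have "{t \<in> Rn n. dotn n t t < 1} \<subseteq> Pi\<^sub>E {..<n} (\<lambda>i. {-1<..<1})"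
  proof
    fix t assume t: "t \<in> {t \<in> Rn n. dotn n t t < 1}"
    have "\<bar>t i\<bar> < 1" if "i < n" for i
    proof -
      have "(t i)\<^sup>2 \<le> dotn n t t"
        unfolding dotn_def power2_eq_square using that by (intro member_le_sum) auto
      then show ?thesis using t by (simp add: abs_square_less_1[symmetric])
    qed
    then show "t \<in> Pi\<^sub>E {..<n} (\<lambda>i. {-1<..<1})" using t by (auto simp: Rn_def PiE_iff abs_less_iff)
  qed
  moreover have "Pi\<^sub>E {..<n} (\<lambda>i. {-1<..<1::real}) \<in> sets (lebn n)"
    unfolding lebn_def by (intro sets_PiM_I_finite) auto
  ultimately have "emeasure (lebn n) {t \<in> Rn n. dotn n t t < 1} \<le> emeasure (lebn n) (Pi\<^sub>E {..<n} (\<lambda>i. {-1<..<1}))"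
    by (intro emeasure_mono)
  also have "\<dots> < \<infinity>" unfolding emeasure_lebn_box by (simp add: power_less_top_ennreal)
  finally show ?thesis .
qed

lemma emeasure_punctured_ball_pos:
  assumes n: "0 < n"
  shows "0 < emeasure (lebn n) {t \<in> Rn n. 0 < dotn n t t \<and> dotn n t t < 1}"
proof -
  \<comment> \<open>Each coordinate of a point in this cube has square below \<open>1/n\<close>, so
    the squares add up to less than 1; all coordinates are positive, so the point is not the
    origin.\<close>
  have "Pi\<^sub>E {..<n} (\<lambda>i. {0<..<1/n}) \<subseteq> {t \<in> Rn n. 0 < dotn n t t \<and> dotn n t t < 1}"
  proof
    fix t assume t: "t \<in> Pi\<^sub>E {..<n} (\<lambda>i. {0<..<1/n})"
    then have ti: "0 < t i" "t i < 1/n" if "i < n" for i using that by (auto simp: PiE_iff)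
    have "0 < dotn n t t" unfolding dotn_def using n ti by (intro sum_pos) auto
    moreover have "dotn n t t < (\<Sum>i<n. 1/n)"
      unfolding dotn_def
    proof (rule sum_strict_mono)
      fix i assume "i \<in> {..<n}"
      then have i: "0 < t i" "t i < 1/n" using ti by auto
      have "1 / real n \<le> 1" using n by simp
      then have "t i * t i < 1/n * 1" using i by (intro mult_strict_mono') auto
      then show "t i * t i < 1/n" by simp
    qed (use n in auto)
    ultimately show "t \<in> {t \<in> Rn n. 0 < dotn n t t \<and> dotn n t t < 1}"
      using t n by (auto simp: Rn_def PiE_iff)
  qed
  then have "emeasure (lebn n) (Pi\<^sub>E {..<n} (\<lambda>i. {0<..<1/n})) \<le> emeasure (lebn n) {t \<in> Rn n. 0 < dotn n t t \<and> dotn n t t < 1}"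
    by (rule emeasure_mono[OF _ punctured_ball_measurable])
  moreover have "0 < emeasure (lebn n) (Pi\<^sub>E {..<n} (\<lambda>i. {0<..<1/n}))"
  proof -
    have "emeasure (lebn n) (Pi\<^sub>E {..<n} (\<lambda>i. {0<..<1/n})) = ennreal ((1/n) ^ n)"
      unfolding emeasure_lebn_box by (subst ennreal_power) simp_all
    then show ?thesis using n by (simp only: ennreal_less_zero_iff) simp
  qed
  ultimately show ?thesis by simp
qed

text \<open>Uniqueness of Haar measure, with the Euclidean ball as the test set.\<close>

theorem distr_lebn_orthogonal:
  assumes us: "orthonormal n us" "length us = n"
  shows "distr (lebn n) (lebn n) (comb n us) = lebn n"
proof (cases "n = 0")
  case True
  then have "comb n us x = x" if "x \<in> Rn n" for x using that by (intro Rn_eqI[of _ n]) auto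
  then have "distr (lebn n) (lebn n) (comb n us) = distr (lebn n) (lebn n) (\<lambda>x. x)"
    by (intro distr_cong) (auto simp: space_lebn)
  then show ?thesis by (simp add: distr_id2)
next
  case False
  interpret sigma_finite_measure "lebn n" by (rule sigma_finite_lebn)
  interpret P: pair_sigma_finite "lebn n" "lebn n" ..
  define B where "B = {t \<in> Rn n. dotn n t t < 1}"
  have B[measurable]: "B \<in> sets (lebn n)" by (simp add: B_def ball_measurable)
  have Bfin: "emeasure (lebn n) B \<noteq> top" using emeasure_ball_finite[of n] by (simp add: B_def)
  have "emeasure (lebn n) {t \<in> Rn n. 0 < dotn n t t \<and> dotn n t t < 1} \<le> emeasure (lebn n) B"
    by (intro emeasure_mono) (auto simp: B_def)
  then have Bpos: "emeasure (lebn n) B \<noteq> 0" using emeasure_punctured_ball_pos[of n] False by auto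
  have surj: "\<exists>s\<in>Rn n. y = comb n us s" if "y \<in> Rn n" for y
    using comb_coords[of n us "Rn n" y] us that orthonormal_basis_Rn_iff[of n us]
    by (metis Rn_simps(2))
  have U[measurable]: "comb n us \<in> lebn n \<rightarrow>\<^sub>M lebn n"
    using measurable_comb[of "\<lambda>x. x" "lebn n" us n] us by simp
  have lin: "lincomb n a (comb n us x) b (comb n us y) = comb n us (lincomb n a x b y)" for a b x y
    using us by (auto simp: lincomb_def comb_def fun_eq_iff sum_distrib_left sum.distrib[symmetric] algebra_simps intro!: sum.cong)
  show ?thesis
  proof (rule measure_eqI)
    fix A assume "A \<in> sets (distr (lebn n) (lebn n) (comb n us))"
    then have A[measurable]: "A \<in> sets (lebn n)" by simp
    \<comment> \<open>Write U for \<open>comb n us\<close>; \<open>?I\<close> measures the pairs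
      with \<open>y\<close> in \<open>B\<close> and \<open>U w + y\<close> in \<open>A\<close>.
      Integrating over \<open>w\<close> first gives the volume of \<open>B\<close> times that of the
      preimage of \<open>A\<close> under U. Integrating over \<open>y\<close> first, shifting
      \<open>y\<close>, and then exchanging the order gives the volume of \<open>B\<close> times
      that of \<open>A\<close>. The factor of \<open>B\<close> is positive and finite, so it
      cancels.\<close>
    let ?I = "\<integral>\<^sup>+ y. (\<integral>\<^sup>+ w. indicator B y * indicator A (lincomb n 1 (comb n us w) 1 y) \<partial>lebn n) \<partial>lebn n"
    have "(\<integral>\<^sup>+ w. indicator A (lincomb n 1 (comb n us w) 1 y) \<partial>lebn n) = emeasure (lebn n) (comb n us -` A \<inter> space (lebn n))"
      if y: "y \<in> Rn n" for y
    proof -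
      obtain s where s: "s \<in> Rn n" "y = comb n us s" using surj[OF y] by blast
      have "(\<integral>\<^sup>+ w. indicator A (lincomb n 1 (comb n us w) 1 y) \<partial>lebn n)
          = (\<integral>\<^sup>+ w. indicator A (comb n us (lincomb n 1 w 1 s)) \<partial>lebn n)"
        by (simp add: s lin)
      also have "\<dots> = (\<integral>\<^sup>+ w. indicator A (comb n us w) \<partial>lebn n)"
        using s by (intro nn_integral_lebn_translation) auto
      also have "\<dots> = (\<integral>\<^sup>+ w. indicator (comb n us -` A \<inter> space (lebn n)) w \<partial>lebn n)"
        by (intro nn_integral_cong) (auto simp: indicator_def)
      finally show ?thesis by simp
    qed
    then have "?I = (\<integral>\<^sup>+ y. indicator B y * emeasure (lebn n) (comb n us -` A \<inter> space (lebn n)) \<partial>lebn n)"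
      by (intro nn_integral_cong, subst nn_integral_cmult) (auto simp: space_lebn intro!: borel_measurable_indicator')
    then have I1: "?I = emeasure (lebn n) B * emeasure (lebn n) (comb n us -` A \<inter> space (lebn n))"
      by (simp add: nn_integral_multc)
    have "?I = (\<integral>\<^sup>+ w. (\<integral>\<^sup>+ y. indicator B y * indicator A (lincomb n 1 (comb n us w) 1 y) \<partial>lebn n) \<partial>lebn n)"
      by (rule P.Fubini') measurable
    also have "\<dots> = (\<integral>\<^sup>+ w. (\<integral>\<^sup>+ y. indicator B (lincomb n 1 y (-1) (comb n us w)) * indicator A y \<partial>lebn n) \<partial>lebn n)"
    proof (rule nn_integral_cong)
      fix w
      let ?f = "\<lambda>y. indicator B (lincomb n 1 y (-1) (comb n us w)) * indicator A y :: ennreal"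
      have w: "comb n us w \<in> space (lebn n)" by (simp add: space_lebn)
      have "(\<integral>\<^sup>+ y. ?f (lincomb n 1 y 1 (comb n us w)) \<partial>lebn n) = integral\<^sup>N (lebn n) ?f"
        using w by (intro nn_integral_lebn_translation) (auto simp: space_lebn)
      moreover have "?f (lincomb n 1 y 1 (comb n us w)) = indicator B y * indicator A (lincomb n 1 (comb n us w) 1 y)"
        if "y \<in> Rn n" for y
      proof -
        have "lincomb n 1 (lincomb n 1 y 1 (comb n us w)) (-1) (comb n us w) = y"
          using that by (intro Rn_eqI[of _ n]) (auto simp: lincomb_def)
        moreover have "lincomb n 1 y 1 (comb n us w) = lincomb n 1 (comb n us w) 1 y"
          by (auto simp: lincomb_def fun_eq_iff)
        ultimately show ?thesis by simp
      qed
      ultimately show "(\<integral>\<^sup>+ y. indicator B y * indicator A (lincomb n 1 (comb n us w) 1 y) \<partial>lebn n) = integral\<^sup>N (lebn n) ?f"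
        by (metis (no_types, lifting) nn_integral_cong space_lebn)
    qed
    also have "\<dots> = (\<integral>\<^sup>+ y. (\<integral>\<^sup>+ w. indicator B (lincomb n 1 y (-1) (comb n us w)) * indicator A y \<partial>lebn n) \<partial>lebn n)"
      by (rule P.Fubini') measurable
    also have "\<dots> = (\<integral>\<^sup>+ y. emeasure (lebn n) B * indicator A y \<partial>lebn n)"
    proof (rule nn_integral_cong)
      fix y assume "y \<in> space (lebn n)"
      then obtain s where s: "s \<in> Rn n" "y = comb n us s" using surj by (auto simp: space_lebn)
      have m: "lincomb n (-1) s 0 s \<in> Rn n" "y \<in> space (lebn n)" by (simp_all add: space_lebn s)
      \<comment> \<open>With \<open>y = U s\<close>, the vector \<open>y - U w\<close> has the same
        length as \<open>w - s\<close>, because U preserves lengths and the ball is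
        symmetric.\<close>
      have "indicator B (lincomb n 1 y (-1) (comb n us w)) = (indicator B (lincomb n 1 w 1 (lincomb n (-1) s 0 s)) :: ennreal)" for w
        unfolding s lin B_def using us
        by (simp add: indicator_def dotn_comb_comb dotn_lincomb_left dotn_lincomb_right algebra_simps)
      then have "(\<integral>\<^sup>+ w. indicator B (lincomb n 1 y (-1) (comb n us w)) \<partial>lebn n)
          = (\<integral>\<^sup>+ w. indicator B (lincomb n 1 w 1 (lincomb n (-1) s 0 s)) \<partial>lebn n)" by simp
      also have "\<dots> = (\<integral>\<^sup>+ w. indicator B w \<partial>lebn n)"
        using m by (intro nn_integral_lebn_translation) auto
      finally have "(\<integral>\<^sup>+ w. indicator B (lincomb n 1 y (-1) (comb n us w)) \<partial>lebn n) = emeasure (lebn n) B" by simp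
      then show "(\<integral>\<^sup>+ w. indicator B (lincomb n 1 y (-1) (comb n us w)) * indicator A y \<partial>lebn n) = emeasure (lebn n) B * indicator A y"
        using m by (subst nn_integral_multc) auto
    qed
    also have "\<dots> = emeasure (lebn n) B * emeasure (lebn n) A" by (simp add: nn_integral_cmult)
    finally have "emeasure (lebn n) B * emeasure (lebn n) (comb n us -` A \<inter> space (lebn n)) = emeasure (lebn n) B * emeasure (lebn n) A"
      using I1 by simp
    then have "emeasure (lebn n) (comb n us -` A \<inter> space (lebn n)) = emeasure (lebn n) A"
      using Bpos Bfin by (simp add: ennreal_mult_cancel_left)
    then show "emeasure (distr (lebn n) (lebn n) (comb n us)) A = emeasure (lebn n) A"
      by (simp add: emeasure_distr)
  qed simp
qed


section \<open>The rotation-invariant probability measure on a sphere\<close>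

lemma sets_lebn: "sets (lebn n) = sets (\<Pi>\<^sub>M i\<in>{..<n}. borel)"
  unfolding lebn_def by (intro sets_PiM_cong) auto

text \<open>The measure of a set is the normalised Lebesgue measure, in orthonormal coordinates of \<open>E\<close>, of
  the part of the cone over the set inside the unit ball.\<close>

theorem exists_rotation_invariant_prob:
  assumes E: "linear_subspace n E" and ne: "unit_sphere n E \<noteq> {}"
  shows "\<exists>\<sigma>. rotation_invariant_prob n E \<sigma>"
proof -
  obtain us where us: "orthonormal_basis n us E" using exists_orthonormal_basis[OF E] .
  then have o: "orthonormal n us" and range: "\<And>t. comb n us t \<in> E" by (auto simp: orthonormal_basis_iff)
  have usR: "set us \<subseteq> Rn n" using o by (simp add: orthonormal_def)
  have ER: "E \<subseteq> Rn n" using E by (simp add: linear_subspace_def)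
  define d where "d = length us"
  have "0 < d"
  proof (rule ccontr)
    assume "\<not> 0 < d"
    then have "dotn n x x = 0" if "x \<in> E" for x
      using dotn_comb_left[of n us "coords n us x" x] comb_coords[OF us that] by (simp add: d_def)
    with ne show False by (auto simp: unit_sphere_def)
  qed
  define B where "B = {t \<in> Rn d. 0 < dotn d t t \<and> dotn d t t < 1}"
  have B[measurable]: "B \<in> sets (lebn d)" by (simp add: B_def punctured_ball_measurable)
  have "emeasure (lebn d) B \<le> emeasure (lebn d) {t \<in> Rn d. dotn d t t < 1}"
    by (intro emeasure_mono ball_measurable) (auto simp: B_def)
  then have Bfin: "emeasure (lebn d) B \<noteq> top" using emeasure_ball_finite[of d] by (auto simp: top_unique)
  have Bpos: "emeasure (lebn d) B \<noteq> 0" using emeasure_punctured_ball_pos[OF \<open>0 < d\<close>] by (simp add: B_def)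
  \<comment> \<open>Radial projection onto the unit sphere; \<open>lincomb d c t 0 t\<close> is the
    multiple of \<open>t\<close> by \<open>c\<close>, kept extensional.\<close>
  define nrm where "nrm t = lincomb d (1 / sqrt (dotn d t t)) t 0 t" for t
  define N where "N t = comb n us (nrm t)" for t
  define S where "S = restrict_space (\<Pi>\<^sub>M i\<in>{..<n}. borel) (unit_sphere n E)"
  have spaceS: "space S = unit_sphere n E"
    using ER by (auto simp: S_def space_restrict_space space_PiM unit_sphere_def Rn_def)
  have nrm1: "dotn d (nrm t) (nrm t) = 1" if "t \<in> B" for t
    using that by (simp add: nrm_def B_def dotn_lincomb_left dotn_lincomb_right)
  have N_sphere: "N t \<in> unit_sphere n E" if "t \<in> B" for t
    using range nrm1[OF that] dotn_comb_comb[OF o] by (simp add: unit_sphere_def N_def d_def)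
  have nrm_meas: "nrm \<in> lebn d \<rightarrow>\<^sub>M lebn d"
  proof (rule measurable_lebnI)
    fix i assume i: "i < d"
    have "(\<lambda>t. dotn d t t) \<in> borel_measurable (lebn d)" by (intro measurable_dotn) auto
    then have "(\<lambda>t. 1 / sqrt (dotn d t t) * t i) \<in> borel_measurable (lebn d)"
      using measurable_component_lebn[OF i] by measurable
    then show "(\<lambda>t. nrm t i) \<in> borel_measurable (lebn d)" using i by (simp add: nrm_def lincomb_def)
  qed (simp add: nrm_def)
  then have "N \<in> lebn d \<rightarrow>\<^sub>M lebn n"
    unfolding N_def d_def by (intro measurable_comb) (simp add: d_def)
  then have "N \<in> restrict_space (lebn d) B \<rightarrow>\<^sub>M (\<Pi>\<^sub>M i\<in>{..<n}. borel)"
    using measurable_cong_sets[OF refl sets_lebn] measurable_restrict_space1 by blast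
  then have N_meas: "N \<in> restrict_space (lebn d) B \<rightarrow>\<^sub>M S"
    unfolding S_def using N_sphere by (intro measurable_restrict_space2) (auto simp: space_restrict_space)
  define \<sigma> where "\<sigma> = scale_measure (1 / emeasure (lebn d) B) (distr (restrict_space (lebn d) B) S N)"
  have spaceB: "space (restrict_space (lebn d) B) = B"
    by (auto simp: space_restrict_space space_lebn B_def)
  have em: "emeasure \<sigma> A = 1 / emeasure (lebn d) B * emeasure (lebn d) {t \<in> B. N t \<in> A}"
    and ms: "{t \<in> B. N t \<in> A} \<in> sets (lebn d)" if A: "A \<in> sets S" for A
  proof -
    have eq: "N -` A \<inter> B = {t \<in> B. N t \<in> A}" by auto
    have "N -` A \<inter> B \<in> sets (restrict_space (lebn d) B)"
      using measurable_sets[OF N_meas A] by (simp add: spaceB)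
    then show "{t \<in> B. N t \<in> A} \<in> sets (lebn d)"
      unfolding eq using B by (auto simp: sets_restrict_space)
    have "emeasure (distr (restrict_space (lebn d) B) S N) A = emeasure (restrict_space (lebn d) B) {t \<in> B. N t \<in> A}"
      using N_meas A by (subst emeasure_distr) (auto simp: spaceB eq)
    also have "\<dots> = emeasure (lebn d) {t \<in> B. N t \<in> A}"
      using B by (intro emeasure_restrict_space) auto
    finally show "emeasure \<sigma> A = 1 / emeasure (lebn d) B * emeasure (lebn d) {t \<in> B. N t \<in> A}"
      by (simp add: \<sigma>_def)
  qed
  have sets\<sigma>: "sets \<sigma> = sets S" "space \<sigma> = space S" by (simp_all add: \<sigma>_def space_scale_measure)
  have "emeasure \<sigma> (space \<sigma>) = 1 / emeasure (lebn d) B * emeasure (lebn d) B"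
  proof -
    have "{t \<in> B. N t \<in> space S} = B" using N_sphere by (auto simp: spaceS)
    then show ?thesis using em[of "space S"] by (simp add: sets\<sigma>)
  qed
  also have "\<dots> = 1"
    using Bpos Bfin by (simp add: ennreal_divide_times less_top)
  finally have prob: "emeasure \<sigma> (space \<sigma>) = 1" .
  have "distr \<sigma> \<sigma> T = \<sigma>" if T: "linear_isometry_on n E T" for T
  proof -
    have TE: "T x \<in> E" if "x \<in> E" for x using T that by (auto simp: linear_isometry_on_def)
    have Tdot: "dotn n (T x) (T y) = dotn n x y" if "x \<in> E" "y \<in> E" for x y
      using T that by (auto simp: linear_isometry_on_def)
    \<comment> \<open>The isometry \<open>T\<close> written in the coordinates of \<open>us\<close>,
      where it acts on a space that carries Lebesgue measure.\<close>
    define W where "W t = coords n us (T (comb n us t))" for t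
    have W: "comb n us (W t) = T (comb n us t)" for t
      unfolding W_def by (rule comb_coords[OF us TE[OF range]])
    have WR: "W t \<in> Rn d" for t by (simp add: W_def d_def)
    have Wdot: "dotn d (W s) (W t) = dotn d s t" for s t
      using dotn_comb_comb[OF o, of "W s" "W t"] dotn_comb_comb[OF o, of s t] Tdot[OF range range]
      by (simp add: W d_def)
    define e where "e j = (\<lambda>k\<in>{..<d}. if k = j then 1 else 0 :: real)" for j :: nat
    \<comment> \<open>The images of the unit vectors. Since \<open>W\<close> preserves dot products,
      the coordinates of \<open>W t\<close> in \<open>vs\<close> are those of \<open>t\<close>;
      hence \<open>W\<close> is \<open>comb d vs\<close> and preserves
      \<open>lebn d\<close>.\<close>
    define vs where "vs = map (\<lambda>j. W (e j)) [0..<d]"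
    have vs: "orthonormal d vs" "length vs = d"
    proof -
      show "length vs = d" by (simp add: vs_def)
      have "dotn d (e i) (e j) = (if i = j then 1 else 0)" if "i < d" "j < d" for i j
        using that dotn_unit[of i d "e j"] by (simp add: e_def)
      then show "orthonormal d vs"
        unfolding orthonormal_def using WR by (auto simp: vs_def Wdot)
    qed
    then have basis: "orthonormal_basis d vs (Rn d)" by (simp add: orthonormal_basis_Rn_iff)
    have Wcomb: "W t = comb d vs t" for t
    proof -
      have "coords d vs (W t) j = t j" if "j < d" for j
        using that dotn_unit[of j d t] dotn_commute[of d t "e j"]
        by (simp add: coords_def vs_def Wdot) (simp add: e_def)
      then have "comb d vs t = comb d vs (coords d vs (W t))"
        using vs by (auto simp: comb_def fun_eq_iff restrict_def intro!: sum.cong)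
      then show ?thesis using comb_coords[OF basis WR] by simp
    qed
    have V: "W \<in> lebn d \<rightarrow>\<^sub>M lebn d"
      unfolding Wcomb using measurable_comb[of "\<lambda>x. x" "lebn d" vs d] vs by simp
    have inv: "emeasure (lebn d) (W -` A \<inter> space (lebn d)) = emeasure (lebn d) A" if "A \<in> sets (lebn d)" for A
      using emeasure_distr[OF V that] distr_lebn_orthogonal[OF vs] Wcomb by (metis ext)
    have T_sphere: "T x \<in> unit_sphere n E" if "x \<in> unit_sphere n E" for x
      using that TE Tdot by (auto simp: unit_sphere_def)
    have T_formula: "T x = comb n us (comb d vs (coords n us x))" if "x \<in> E" for x
      using W[of "coords n us x"] comb_coords[OF us that] by (simp add: Wcomb)
    \<comment> \<open>\<open>T\<close> is arbitrary outside \<open>E\<close>, so its measurability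
      on the sphere comes from this globally measurable map, which agrees with it on
      \<open>E\<close>.\<close>
    have "(\<lambda>x. comb n us (comb d vs (coords n us x))) \<in> lebn n \<rightarrow>\<^sub>M lebn n"
    proof -
      have "(\<lambda>x. coords n us x) \<in> lebn n \<rightarrow>\<^sub>M lebn d"
        unfolding d_def by (rule measurable_coords[OF _ usR]) simp
      then have "(\<lambda>x. comb d vs (coords n us x)) \<in> lebn n \<rightarrow>\<^sub>M lebn d"
        using vs by (intro measurable_comb) simp
      then show ?thesis unfolding d_def by (rule measurable_comb)
    qed
    then have "(\<lambda>x. comb n us (comb d vs (coords n us x))) \<in> S \<rightarrow>\<^sub>M (\<Pi>\<^sub>M i\<in>{..<n}. borel)"
      unfolding S_def using measurable_cong_sets[OF sets_lebn sets_lebn] measurable_restrict_space1 by blast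
    also have "?this \<longleftrightarrow> T \<in> S \<rightarrow>\<^sub>M (\<Pi>\<^sub>M i\<in>{..<n}. borel)"
      by (intro measurable_cong) (simp add: T_formula spaceS unit_sphere_def)
    finally have T_meas: "T \<in> S \<rightarrow>\<^sub>M S"
      unfolding S_def
      by (intro measurable_restrict_space2) (use T_sphere spaceS in \<open>auto simp: S_def\<close>)
    then have T_meas': "T \<in> \<sigma> \<rightarrow>\<^sub>M \<sigma>" using measurable_cong_sets[OF sets\<sigma>(1) sets\<sigma>(1)] by blast
    have WB: "W t \<in> B \<longleftrightarrow> t \<in> B" if "t \<in> Rn d" for t
      using that WR by (simp add: B_def Wdot)
    \<comment> \<open>An isometry commutes with radial projection, as it preserves lengths.\<close>
    have TN: "T (N t) = N (W t)" for t
    proof -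
      have "W (nrm t) = nrm (W t)"
        unfolding nrm_def Wdot unfolding Wcomb using vs
        by (auto simp: lincomb_def comb_def fun_eq_iff sum_divide_distrib)
      then show ?thesis by (simp add: N_def W[symmetric])
    qed
    show ?thesis
    proof (rule measure_eqI)
      fix A assume "A \<in> sets (distr \<sigma> \<sigma> T)"
      then have A: "A \<in> sets S" by (simp add: sets\<sigma>)
      have TA: "T -` A \<inter> space S \<in> sets S" using measurable_sets[OF T_meas A] .
      have "{t \<in> B. N t \<in> T -` A \<inter> space S} = W -` {t \<in> B. N t \<in> A} \<inter> space (lebn d)"
        using N_sphere WB by (auto simp: spaceS TN space_lebn) (auto simp: B_def)
      then have "emeasure (lebn d) {t \<in> B. N t \<in> T -` A \<inter> space S} = emeasure (lebn d) {t \<in> B. N t \<in> A}"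
        using inv[OF ms[OF A]] by simp
      then have "emeasure \<sigma> (T -` A \<inter> space \<sigma>) = emeasure \<sigma> A"
        using em[OF TA] em[OF A] by (simp add: sets\<sigma>)
      then show "emeasure (distr \<sigma> \<sigma> T) A = emeasure \<sigma> A"
        using T_meas' A by (simp add: emeasure_distr sets\<sigma>)
    qed simp
  qed
  with prob sets\<sigma>(1) show ?thesis
    unfolding rotation_invariant_prob_def S_def by blast
qed

lemma sphere_measure_prob:
  assumes E: "linear_subspace n E" and ne: "unit_sphere n E \<noteq> {}"
  shows "space (sphere_measure n E) = unit_sphere n E"
    "emeasure (sphere_measure n E) (space (sphere_measure n E)) = 1"
proof -
  have *: "rotation_invariant_prob n E (sphere_measure n E)"
    unfolding sphere_measure_def by (rule someI_ex[OF exists_rotation_invariant_prob[OF E ne]])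
  then show "emeasure (sphere_measure n E) (space (sphere_measure n E)) = 1"
    by (simp add: rotation_invariant_prob_def)
  have "space (sphere_measure n E) = space (restrict_space (\<Pi>\<^sub>M i\<in>{..<n}. borel) (unit_sphere n E))"
    using * by (intro sets_eq_imp_space_eq) (simp add: rotation_invariant_prob_def)
  then show "space (sphere_measure n E) = unit_sphere n E"
    using E by (auto simp: space_restrict_space space_PiM unit_sphere_def Rn_def linear_subspace_def)
qed

text \<open>Monotonicity of the nonnegative integral holds for arbitrary functions, and the total
  mass is 1, so pointwise bounds on the section volumes pass to their average.\<close>

lemma nn_integral_sphere_bounds:
  assumes E: "linear_subspace n E" "unit_sphere n E \<noteq> {}"
    and f: "\<And>\<theta>. \<theta> \<in> unit_sphere n E \<Longrightarrow> a \<le> f \<theta> \<and> f \<theta> \<le> b"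
  shows "a \<le> (\<integral>\<^sup>+ \<theta>. f \<theta> \<partial>sphere_measure n E) \<and> (\<integral>\<^sup>+ \<theta>. f \<theta> \<partial>sphere_measure n E) \<le> b"
proof -
  note s = sphere_measure_prob[OF E]
  have "(\<integral>\<^sup>+ \<theta>. a \<partial>sphere_measure n E) \<le> (\<integral>\<^sup>+ \<theta>. f \<theta> \<partial>sphere_measure n E)"
    "(\<integral>\<^sup>+ \<theta>. f \<theta> \<partial>sphere_measure n E) \<le> (\<integral>\<^sup>+ \<theta>. b \<partial>sphere_measure n E)"
    by (intro nn_integral_mono; simp add: s(1) f)+
  then show ?thesis by (simp add: s(2))
qed


section \<open>Isotropic log-concave densities\<close>

lemma has_bochner_integral_le:
  fixes f g :: "'a \<Rightarrow> real"
  assumes "has_bochner_integral M f a" "has_bochner_integral M g b" "\<And>x. f x \<le> g x"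
  shows "a \<le> b"
  using assms integral_mono[of M f g] by (auto simp: has_bochner_integral_iff)

lemma has_bochner_integral_lborel_scaleR:
  fixes g :: "'a::euclidean_space \<Rightarrow> real"
  assumes g: "has_bochner_integral lborel g I" and c: "c \<noteq> 0"
  shows "has_bochner_integral lborel (\<lambda>x. g (c *\<^sub>R x)) (I / \<bar>c\<bar> ^ DIM('a))"
proof -
  have [measurable]: "g \<in> borel_measurable borel"
    using g by (auto dest: borel_measurable_has_bochner_integral)
  have eq: "(lborel :: 'a measure) = density (distr lborel borel (\<lambda>x. c *\<^sub>R x)) (\<lambda>_. ennreal (\<bar>c\<bar> ^ DIM('a)))"
    using lborel_affine[OF c, of "0::'a"] by (simp add: ennreal_power)
  have "has_bochner_integral (density (distr lborel borel (\<lambda>x::'a. c *\<^sub>R x)) (\<lambda>_. ennreal (\<bar>c\<bar> ^ DIM('a)))) g I"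
    using g by (subst (asm) eq)
  then have "has_bochner_integral lborel (\<lambda>x. \<bar>c\<bar> ^ DIM('a) * g (c *\<^sub>R x)) I"
    by (simp add: has_bochner_integral_iff integral_density integrable_density integral_distr integrable_distr_eq)
  from has_bochner_integral_divide_zero[OF this, of "\<bar>c\<bar> ^ DIM('a)"] show ?thesis
    using c by simp
qed

lemma integrable_gaussian:
  "integrable lborel (\<lambda>x::'a::euclidean_space. exp (- (norm x)\<^sup>2))"
proof (rule integrableI_nonneg)
  have fin: "(\<integral>\<^sup>+x. ennreal (exp (- x\<^sup>2)) \<partial>lborel) < \<infinity>"
  proof -
    \<comment> \<open>A normal density of variance 1/2 is \<open>exp (- x^2)\<close> divided by the
      square root of pi. The general case is a product over the basis.\<close>
    have "integrable lborel (\<lambda>x. normal_density 0 (sqrt (1/2)) x * sqrt pi)"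
      by (intro integrable_mult_left integrable_normal_density) auto
    also have "(\<lambda>x. normal_density 0 (sqrt (1/2)) x * sqrt pi) = (\<lambda>x. exp (- x\<^sup>2))"
      by (simp add: normal_density_def fun_eq_iff)
    finally show ?thesis
      by (subst (asm) integrable_iff_bounded) simp
  qed
  have "(\<integral>\<^sup>+x. ennreal (exp (- (norm x)\<^sup>2)) \<partial>(lborel::'a measure))
      = (\<integral>\<^sup>+x. (\<Prod>b\<in>Basis. ennreal (exp (- (x \<bullet> b)\<^sup>2))) \<partial>(lborel::'a measure))"
  proof (intro nn_integral_cong)
    fix x :: 'a
    have "(norm x)\<^sup>2 = (\<Sum>b\<in>Basis. (x \<bullet> b)\<^sup>2)"
      by (subst power2_norm_eq_inner, subst euclidean_inner) (simp add: power2_eq_square)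
    then show "ennreal (exp (- (norm x)\<^sup>2)) = (\<Prod>b\<in>Basis. ennreal (exp (- (x \<bullet> b)\<^sup>2)))"
      by (simp add: prod_ennreal exp_sum sum_negf[symmetric])
  qed
  also have "\<dots> = (\<Prod>b\<in>(Basis::'a set). (\<integral>\<^sup>+x. ennreal (exp (- x\<^sup>2)) \<partial>lborel))"
    by (rule nn_integral_lborel_prod) auto
  also have "\<dots> < \<infinity>"
    using fin unfolding prod_constant by (simp only: power_less_top_ennreal infinity_ennreal_def simp_thms)
  finally show "(\<integral>\<^sup>+x. ennreal (exp (- (norm x)\<^sup>2)) \<partial>(lborel::'a measure)) < \<infinity>" .
qed auto

text \<open>The properties that a marginal of an isotropic body inherits. The \<open>powr\<close>
  form of log-concavity remains meaningful at zeros of \<open>f\<close>, since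
  \<open>0 powr r = 0\<close>, whereas \<open>ln\<close> has no value minus infinity.\<close>

locale isotropic_logconcave =
  fixes f :: "'a::euclidean_space \<Rightarrow> real" and L :: real
  assumes L_pos: "0 < L"
    and nonneg: "\<And>x. 0 \<le> f x"
    and total: "has_bochner_integral lborel f 1"
    and mean: "\<And>u. has_bochner_integral lborel (\<lambda>x. (x \<bullet> u) * f x) 0"
    and var: "\<And>u. norm u = 1 \<Longrightarrow> has_bochner_integral lborel (\<lambda>x. (x \<bullet> u)\<^sup>2 * f x) (L\<^sup>2)"
    and logconcave: "\<And>x y t. 0 < t \<Longrightarrow> t < 1 \<Longrightarrow>
      f x powr (1 - t) * f y powr t \<le> f ((1 - t) *\<^sub>R x + t *\<^sub>R y)"
begin

section \<open>Lower bound at the origin: separation and entropy\<close>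

lemma second_moment:
  "has_bochner_integral lborel (\<lambda>x. (norm x)\<^sup>2 * f x) (DIM('a) * L\<^sup>2)"
proof -
  have "has_bochner_integral lborel (\<lambda>x. \<Sum>b\<in>Basis. (x \<bullet> b)\<^sup>2 * f x) (\<Sum>b\<in>(Basis::'a set). L\<^sup>2)"
    by (intro has_bochner_integral_sum var) simp
  also have "(\<lambda>x. \<Sum>b\<in>Basis. (x \<bullet> b)\<^sup>2 * f x) = (\<lambda>x. (norm x)\<^sup>2 * f x)"
    by (subst power2_norm_eq_inner, subst euclidean_inner)
       (simp add: power2_eq_square sum_distrib_right fun_eq_iff)
  finally show ?thesis by simp
qed

text \<open>Otherwise \<open>(x \<bullet> p) * f x\<close> has constant sign and integral 0, so it
  vanishes almost everywhere; hyperplanes are null, so \<open>f\<close> would vanish almost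
  everywhere too. This rules out a vertical separating hyperplane in
  \<open>exponential_majorant\<close>.\<close>

lemma support_not_in_halfspace:
  assumes p: "p \<noteq> 0" and le: "\<And>x. 0 < f x \<Longrightarrow> p \<bullet> x \<le> 0"
  shows False
proof -
  have hyp: "has_bochner_integral lborel (\<lambda>x. - ((x \<bullet> p) * f x)) 0"
    using has_bochner_integral_minus[OF mean[of p]] by simp
  have nn: "0 \<le> - ((x \<bullet> p) * f x)" for x
  proof (cases "f x = 0")
    case False
    then have "0 < f x" using nonneg[of x] by simp
    with le[of x] have "(x \<bullet> p) * f x \<le> 0"
      by (intro mult_nonpos_nonneg) (auto simp: inner_commute)
    then show ?thesis by simp
  qed simp
  have "AE x in lborel. - ((x \<bullet> p) * f x) = 0"
  proof (subst integral_nonneg_eq_0_iff_AE[symmetric])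
    show "integrable lborel (\<lambda>x. - ((x \<bullet> p) * f x))" "integral\<^sup>L lborel (\<lambda>x. - ((x \<bullet> p) * f x)) = 0"
      using hyp unfolding has_bochner_integral_iff by (rule conjunct1, rule conjunct2)
  qed (use nn in auto)
  moreover have "AE x in lborel. x \<bullet> p \<noteq> 0"
  proof -
    have "{x. p \<bullet> x = 0} \<in> null_sets lborel"
      using negligible_hyperplane[of p 0] p
      by (simp add: negligible_iff_null_sets null_sets_completion_iff)
    then show ?thesis by (rule AE_I') (auto simp: inner_commute)
  qed
  ultimately have "AE x in lborel. f x = 0" by eventually_elim auto
  then have "integral\<^sup>L lborel f = 0" by (rule integral_eq_zero_AE)
  with total show False by (simp add: has_bochner_integral_iff)
qed

lemma ln_logconcave:
  assumes "0 < f x" "0 < f y" "0 < t" "t < 1"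
  shows "0 < f ((1 - t) *\<^sub>R x + t *\<^sub>R y)"
    "(1 - t) * ln (f x) + t * ln (f y) \<le> ln (f ((1 - t) *\<^sub>R x + t *\<^sub>R y))"
proof -
  have pos: "0 < f x powr (1 - t) * f y powr t" using assms by simp
  then show *: "0 < f ((1 - t) *\<^sub>R x + t *\<^sub>R y)"
    using logconcave[OF assms(3,4), of x y] by linarith
  have "(1 - t) * ln (f x) + t * ln (f y) = ln (f x powr (1 - t) * f y powr t)"
    using assms by (simp add: ln_mult ln_powr)
  also have "\<dots> \<le> ln (f ((1 - t) *\<^sub>R x + t *\<^sub>R y))"
    using pos logconcave[OF assms(3,4), of x y] by (subst ln_le_cancel_iff) (use * in auto)
  finally show "(1 - t) * ln (f x) + t * ln (f y) \<le> ln (f ((1 - t) *\<^sub>R x + t *\<^sub>R y))" .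
qed

text \<open>An affine majorant of the concave function \<open>ln f\<close>, found by separating its
  hypograph over the positivity set from the point \<open>(0, ln b)\<close>. A positive
  \<open>b\<close> strictly above \<open>f 0\<close> covers the case \<open>f 0 = 0\<close>;
  \<open>lower_bound_0\<close> then lets \<open>b\<close> decrease to \<open>f 0\<close>.\<close>

lemma exponential_majorant:
  assumes b: "0 < b" "f 0 < b"
  obtains p where "\<And>x. f x \<le> b * exp (p \<bullet> x)"
proof -
  define H where "H = {z. 0 < f (fst z) \<and> snd z \<le> ln (f (fst z))}"
  have "convex H"
    unfolding convex_alt
  proof (intro ballI allI impI)
    fix z w :: "'a \<times> real" and t :: real
    assume zw: "z \<in> H" "w \<in> H" and t: "0 \<le> t \<and> t \<le> 1"
    consider "t = 0" | "t = 1" | "0 < t" "t < 1" using t by linarith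
    then show "(1 - t) *\<^sub>R z + t *\<^sub>R w \<in> H"
    proof cases
      case 3
      have "(1 - t) * snd z + t * snd w \<le> (1 - t) * ln (f (fst z)) + t * ln (f (fst w))"
        using zw 3 by (intro add_mono mult_left_mono) (auto simp: H_def)
      then show ?thesis
        using ln_logconcave[of "fst z" "fst w" t] zw 3 by (auto simp: H_def)
    qed (use zw in auto)
  qed
  moreover obtain x0 where x0: "0 < f x0"
  proof -
    have "\<exists>x. f x \<noteq> 0"
    proof (rule ccontr)
      assume "\<nexists>x. f x \<noteq> 0"
      then have "f = (\<lambda>_. 0)" by auto
      with total show False by (simp add: has_bochner_integral_iff)
    qed
    then show ?thesis using that nonneg by (metis less_eq_real_def)
  qed
  moreover have "H \<inter> {(0, ln b)} = {}"
    using b by (auto simp: H_def)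
  moreover have "(x0, ln (f x0)) \<in> H" using x0 by (simp add: H_def)
  ultimately obtain a c where a: "a \<noteq> 0" "\<And>z. z \<in> H \<Longrightarrow> a \<bullet> z \<le> c" "c \<le> a \<bullet> (0, ln b)"
    using separating_hyperplane_sets[of H "{(0, ln b)}"] by (metis convex_singleton empty_iff insert_not_empty singletonI)
  obtain p q where pq: "a = (p, q)" by (cases a)
  have le: "p \<bullet> x + q * y \<le> q * ln b" if "0 < f x" "y \<le> ln (f x)" for x y
    using a(2)[of "(x, y)"] a(3) that by (auto simp: H_def pq)
  have "0 \<le> q"
  proof (rule ccontr)
    assume "\<not> 0 \<le> q"
    then have q: "q < 0" by simp
    \<comment> \<open>The hypograph extends downwards without bound. \<open>r\<close> is the height
      at which the hyperplane passes over \<open>x0\<close>; with \<open>q < 0\<close>, points at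
      height \<open>r - 1\<close> or lower are on the wrong side.\<close>
    define r where "r = (q * ln b - p \<bullet> x0) / q"
    have r: "q * r = q * ln b - p \<bullet> x0" using q by (simp add: r_def)
    have "q * (r - 1) \<le> q * min (ln (f x0)) (r - 1)"
      using q by (intro mult_left_mono_neg) auto
    then show False using le[OF x0, of "min (ln (f x0)) (r - 1)"] q r by (simp add: algebra_simps)
  qed
  \<comment> \<open>With \<open>q = 0\<close> the separating hyperplane is vertical and confines the
    support of \<open>f\<close> to a half-space.\<close>
  moreover have "q \<noteq> 0"
  proof
    assume "q = 0"
    with a(1) pq have "p \<noteq> 0" by (auto simp: zero_prod_def)
    then show False
      by (rule support_not_in_halfspace) (use le[of _ "ln (f _)"] \<open>q = 0\<close> in auto)
  qed
  ultimately have q: "0 < q" by simp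
  have "f x \<le> b * exp ((- (1/q) *\<^sub>R p) \<bullet> x)" for x
  proof (cases "f x = 0")
    case False
    then have fx: "0 < f x" using nonneg[of x] by simp
    have "q * ln (f x) \<le> q * (ln b + (- (1/q) *\<^sub>R p) \<bullet> x)"
      using le[OF fx order_refl] q unfolding distrib_left by simp
    then have "ln (f x) \<le> ln b + (- (1/q) *\<^sub>R p) \<bullet> x"
      using q by (simp only: mult_le_cancel_left_pos)
    then have "exp (ln (f x)) \<le> exp (ln b + (- (1/q) *\<^sub>R p) \<bullet> x)" by (simp only: exp_le_cancel_iff)
    then show ?thesis using fx b unfolding exp_add by simp
  qed (use b in auto)
  then show ?thesis by (rule that)
qed

text \<open>Integrating \<open>ln f \<le> ln b + p \<bullet> x\<close> against \<open>f\<close> kills the linear term, as \<open>f\<close> is centered; what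
  remains bounds \<open>ln b\<close> from below by minus the entropy of \<open>f\<close>, and a Gaussian of variance
  \<open>L\<^sup>2\<close> bounds the entropy from above.\<close>

lemma lower_bound_0:
  "exp (1 - real DIM('a) - (\<integral>x. exp (- (norm (x::'a))\<^sup>2) \<partial>lborel)) / L ^ DIM('a) \<le> f 0"
proof (rule dense_ge)
  fix b assume b: "f 0 < b"
  then have b0: "0 < b" using nonneg[of 0] by linarith
  obtain p where p: "\<And>x. f x \<le> b * exp (p \<bullet> x)" using exponential_majorant[OF b0 b] by blast
  define D where "D = real DIM('a)"
  define C where "C = (\<integral>x. exp (- (norm (x::'a))\<^sup>2) \<partial>lborel)"
  \<comment> \<open>A Gaussian of scale \<open>L\<close> and total mass \<open>C\<close>, not
    normalised to 1; this is how the Gaussian integral enters the final constant.\<close>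
  define G :: "'a \<Rightarrow> real" where "G x = exp (- (norm ((1/L) *\<^sub>R x))\<^sup>2) / L ^ DIM('a)" for x
  have "has_bochner_integral lborel (\<lambda>x::'a. exp (- (norm x)\<^sup>2)) C"
    unfolding C_def using integrable_gaussian by (rule has_bochner_integral_integrable)
  from has_bochner_integral_divide_zero[OF has_bochner_integral_lborel_scaleR[OF this, of "1/L"], of "L ^ DIM('a)"]
  have G: "has_bochner_integral lborel G C"
    using L_pos by (simp add: G_def[abs_def] power_divide)
  have lnG: "ln (G x) = - (norm x)\<^sup>2 / L\<^sup>2 - D * ln L" for x
    using L_pos by (simp add: G_def ln_div ln_realpow D_def power_divide)
  have Gpos: "0 < G x" for x using L_pos by (simp add: G_def)
  \<comment> \<open>The inequality \<open>ln s \<le> s - 1\<close> at \<open>s = G x / f x\<close>,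
    multiplied by \<open>f x\<close>, combined with the affine majorant. In this form it also holds
    where \<open>f\<close> vanishes.\<close>
  have pt: "- D * ln L * f x - (norm x)\<^sup>2 * f x / L\<^sup>2 + f x - G x \<le> ln b * f x + (x \<bullet> p) * f x" for x
  proof (cases "f x = 0")
    case True then show ?thesis using Gpos[of x] by simp
  next
    case False
    then have fx: "0 < f x" using nonneg[of x] by simp
    have "ln (f x) \<le> ln (b * exp (p \<bullet> x))" using p[of x] fx b0 by (subst ln_le_cancel_iff) auto
    also have "\<dots> = ln b + x \<bullet> p" using b0 by (simp add: ln_mult inner_commute)
    finally have 1: "ln (f x) \<le> ln b + x \<bullet> p" .
    have "ln (G x / f x) \<le> G x / f x - 1" using fx Gpos[of x] by (intro ln_le_minus_one) auto
    then have 2: "ln (G x) - ln (f x) \<le> G x / f x - 1" using fx Gpos[of x] by (simp add: ln_div)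
    have "f x * (ln (G x) - (G x / f x - 1)) \<le> f x * (ln b + x \<bullet> p)"
      using 1 2 fx by (intro mult_left_mono) auto
    then show ?thesis using fx unfolding lnG by (simp add: algebra_simps)
  qed
  have "has_bochner_integral lborel
      (\<lambda>x. - D * ln L * f x - (norm x)\<^sup>2 * f x / L\<^sup>2 + f x - G x)
      (- D * ln L * 1 - D * L\<^sup>2 / L\<^sup>2 + 1 - C)"
    unfolding D_def
    by (intro has_bochner_integral_add has_bochner_integral_diff has_bochner_integral_mult_right
        has_bochner_integral_divide_zero total G second_moment)
  moreover have "has_bochner_integral lborel (\<lambda>x. ln b * f x + (x \<bullet> p) * f x) (ln b * 1 + 0)"
    by (intro has_bochner_integral_add has_bochner_integral_mult_right total mean)
  ultimately have "- D * ln L * 1 - D * L\<^sup>2 / L\<^sup>2 + 1 - C \<le> ln b * 1 + 0"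
    using pt by (rule has_bochner_integral_le)
  then have "(1 - D - C) - D * ln L \<le> ln b" using L_pos by simp
  then have "exp ((1 - D - C) - D * ln L) \<le> b" using b0 by (simp only: ln_ge_iff)
  also have "exp ((1 - D - C) - D * ln L) = exp (1 - D - C) / L ^ DIM('a)"
    using L_pos by (simp add: exp_diff D_def exp_of_nat_mult)
  finally show "exp (1 - real DIM('a) - (\<integral>x. exp (- (norm (x::'a))\<^sup>2) \<partial>lborel)) / L ^ DIM('a) \<le> b"
    by (simp add: C_def D_def)
qed

section \<open>Upper bound at the origin: width of level sets\<close>

text \<open>If \<open>f x = f 0 * exp (- r)\<close> with \<open>r \<ge> 1\<close>, then \<open>x / r\<close> lies in the level set, so
  \<open>(x \<bullet> u)\<^sup>2 f x \<le> w\<^sup>2 r\<^sup>2 f x\<close>, and \<open>r\<^sup>2 f x \<le> 8 exp (r / 2) f x \<le> 8 f (x / 2)\<close>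
  is integrable.\<close>

lemma level_set_width:
  assumes f0: "0 < f 0" and u: "norm u = 1"
    and w: "\<And>x. f 0 / exp 1 \<le> f x \<Longrightarrow> \<bar>x \<bullet> u\<bar> \<le> w"
  shows "L\<^sup>2 \<le> (1 + 8 * 2 ^ DIM('a)) * w\<^sup>2"
proof -
  have pt: "(x \<bullet> u)\<^sup>2 * f x \<le> w\<^sup>2 * (f x + 8 * f ((1/2) *\<^sub>R x))" for x
  proof (cases "f x = 0")
    case True then show ?thesis using nonneg[of "(1/2) *\<^sub>R x"] by simp
  next
    case False
    then have fx: "0 < f x" using nonneg[of x] by simp
    define r where "r = ln (f 0 / f x)"
    have fr: "f x = f 0 * exp (- r)" using fx f0 by (simp add: r_def exp_minus)
    show ?thesis
    proof (cases "r \<le> 1")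
      case True
      have "f 0 * exp (- 1) \<le> f x" unfolding fr using True f0 by (intro mult_left_mono) auto
      then have "\<bar>x \<bullet> u\<bar> \<le> w" by (intro w) (simp add: exp_minus field_simps)
      then have "(x \<bullet> u)\<^sup>2 \<le> w\<^sup>2" by (metis abs_ge_zero power2_abs power_mono)
      then have "(x \<bullet> u)\<^sup>2 * f x \<le> w\<^sup>2 * f x" using fx by (intro mult_right_mono) auto
      also have "\<dots> \<le> w\<^sup>2 * (f x + 8 * f ((1/2) *\<^sub>R x))"
        using nonneg[of "(1/2) *\<^sub>R x"] by (intro mult_left_mono) auto
      finally show ?thesis .
    next
      case False
      then have r: "1 < r" by simp
      have lx: "ln (f x) = ln (f 0) - r" using fx f0 by (simp add: r_def ln_div)
      \<comment> \<open>The point \<open>x / r\<close> has weight \<open>1/r\<close> on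
        \<open>x\<close>, so \<open>ln f\<close> drops by at most \<open>r / r = 1\<close> from its
        value at 0.\<close>
      have "0 < f ((1/r) *\<^sub>R x)" "(1 - 1/r) * ln (f 0) + (1/r) * ln (f x) \<le> ln (f ((1/r) *\<^sub>R x))"
        using ln_logconcave[OF f0 fx, of "1/r"] r by auto
      moreover have "(1 - 1/r) * ln (f 0) + (1/r) * ln (f x) = ln (f 0 / exp 1)"
        using r f0 unfolding lx by (simp add: ln_div field_simps)
      ultimately have "f 0 / exp 1 \<le> f ((1/r) *\<^sub>R x)" using f0 by simp
      from w[OF this] have "\<bar>x \<bullet> u\<bar> \<le> w * r" using r by (simp add: field_simps)
      then have xu: "(x \<bullet> u)\<^sup>2 \<le> w\<^sup>2 * r\<^sup>2"
        by (metis abs_ge_zero power2_abs power_mono power_mult_distrib)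
      \<comment> \<open>The quadratic Taylor term of \<open>exp\<close> at \<open>r / 2\<close> is
        \<open>r^2 / 8\<close>.\<close>
      have "r\<^sup>2 \<le> 8 * exp (r / 2)"
        using exp_lower_Taylor_quadratic[of "r/2"] r by (simp add: power2_eq_square)
      then have 1: "r\<^sup>2 * f x \<le> 8 * (exp (r/2) * f x)" using fx by (simp add: mult_right_mono flip: mult.assoc)
      have "exp (r/2) * f x = exp (r/2 + ln (f x))" using fx by (simp only: exp_add exp_ln)
      also have "\<dots> = exp ((1 - 1/2) * ln (f 0) + (1/2) * ln (f x))" unfolding lx by (simp add: field_simps)
      also have "\<dots> \<le> exp (ln (f ((1/2) *\<^sub>R x)))"
        using ln_logconcave(2)[OF f0 fx, of "1/2"] by simp
      also have "\<dots> = f ((1/2) *\<^sub>R x)"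
        using ln_logconcave(1)[OF f0 fx, of "1/2"] by simp
      finally have 2: "exp (r/2) * f x \<le> f ((1/2) *\<^sub>R x)" .
      from 1 2 have "r\<^sup>2 * f x \<le> 8 * f ((1/2) *\<^sub>R x)" by linarith
      then have "w\<^sup>2 * (r\<^sup>2 * f x) \<le> w\<^sup>2 * (f x + 8 * f ((1/2) *\<^sub>R x))"
        using fx by (intro mult_left_mono) auto
      moreover have "(x \<bullet> u)\<^sup>2 * f x \<le> w\<^sup>2 * r\<^sup>2 * f x" using xu fx by (intro mult_right_mono) auto
      ultimately show ?thesis by (simp add: mult.assoc)
    qed
  qed
  have "has_bochner_integral lborel (\<lambda>x. w\<^sup>2 * (f x + 8 * f ((1/2) *\<^sub>R x))) (w\<^sup>2 * (1 + 8 * (1 / \<bar>1/2\<bar> ^ DIM('a))))"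
    by (intro has_bochner_integral_add has_bochner_integral_mult_right total
        has_bochner_integral_lborel_scaleR[OF total, of "1/2"]) auto
  from has_bochner_integral_le[OF var[OF u] this pt] 
  have "L\<^sup>2 \<le> w\<^sup>2 * (1 + 8 * (1 / \<bar>1/2\<bar> ^ DIM('a)))" by simp
  then show ?thesis by (simp add: power_divide mult.commute)
qed

lemma level_set_wide:
  assumes "0 < f 0" "norm u = 1" "(1 + 8 * 2 ^ DIM('a)) * w\<^sup>2 < L\<^sup>2"
  obtains x where "f 0 / exp 1 \<le> f x" "w < \<bar>x \<bullet> u\<bar>"
  using level_set_width[OF assms(1,2), of w] assms(3) by (meson not_le)

lemma convex_level_set:
  assumes "0 < c"
  shows "convex {x. c \<le> f x}"
  unfolding convex_alt
proof (intro ballI allI impI)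
  fix x y t assume xy: "x \<in> {x. c \<le> f x}" "y \<in> {x. c \<le> f x}" and t: "0 \<le> t \<and> t \<le> (1::real)"
  consider "t = 0" | "t = 1" | "0 < t" "t < 1" using t by linarith
  then show "(1 - t) *\<^sub>R x + t *\<^sub>R y \<in> {x. c \<le> f x}"
  proof cases
    case 3
    have "c = c powr (1 - t) * c powr t" using assms by (simp add: powr_add[symmetric])
    also have "\<dots> \<le> f x powr (1 - t) * f y powr t"
      using xy 3 assms by (intro mult_mono powr_mono2) auto
    also have "\<dots> \<le> f ((1 - t) *\<^sub>R x + t *\<^sub>R y)" using logconcave 3 by blast
    finally show ?thesis by simp
  qed (use xy in auto)
qed

text \<open>Markov's inequality for a density of total mass 1.\<close>

lemma level_set_measure:
  assumes S: "S \<in> sets borel" "emeasure lborel S < \<infinity>" and le: "\<And>x. x \<in> S \<Longrightarrow> c \<le> f x"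
  shows "c * measure lborel S \<le> 1"
proof -
  have "has_bochner_integral lborel (\<lambda>x. c * indicator S x) (c * measure lborel S)"
    using S by (intro has_bochner_integral_mult_right has_bochner_integral_real_indicator) auto
  then show ?thesis
    by (rule has_bochner_integral_le[OF _ total]) (auto simp: indicator_def le nonneg)
qed

end

lemma upper_bound_real:
  fixes f :: "real \<Rightarrow> real"
  assumes "isotropic_logconcave f L"
  shows "f 0 \<le> 30 / L"
proof (cases "f 0 \<le> 0")
  case True
  then show ?thesis using isotropic_logconcave.L_pos[OF assms] by (auto intro: order_trans)
next
  case False
  interpret isotropic_logconcave f L by fact
  have f0: "0 < f 0" using False by simp
  \<comment> \<open>In dimension 1 the factor of \<open>level_set_width\<close> is 17, which is less
    than 25; hence \<open>L/5\<close>.\<close>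
  obtain x where x: "f 0 / exp 1 \<le> f x" "L/5 < \<bar>x\<bar>"
    using level_set_wide[OF f0, of 1 "L/5"] L_pos by (auto simp: power_divide)
  have "convex {x. f 0 / exp 1 \<le> f x}" using f0 by (intro convex_level_set) simp
  then have "closed_segment 0 x \<subseteq> {x. f 0 / exp 1 \<le> f x}"
    using x f0 by (intro closed_segment_subset) (auto simp: divide_le_eq)
  then have "f 0 / exp 1 * measure lborel (closed_segment 0 x) \<le> 1"
    by (intro level_set_measure) (auto simp: closed_segment_eq_real_ivl)
  also have "measure lborel (closed_segment 0 x) = \<bar>x\<bar>"
    by (auto simp: closed_segment_eq_real_ivl)
  finally have 1: "f 0 * \<bar>x\<bar> \<le> exp 1" by (simp add: field_simps)
  have "f 0 * (L/5) \<le> f 0 * \<bar>x\<bar>" using x f0 by (intro mult_left_mono) auto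
  also note 1
  also have "exp (1::real) \<le> 3" by (rule exp_le)
  finally have "f 0 * L \<le> 15" by simp
  then show ?thesis using L_pos by (simp add: field_simps)
qed

lemma upper_bound_real_2:
  fixes f :: "real ^ 2 \<Rightarrow> real"
  assumes "isotropic_logconcave f L"
  shows "f 0 \<le> 400 / L\<^sup>2"
proof (cases "f 0 \<le> 0")
  case True
  then show ?thesis using isotropic_logconcave.L_pos[OF assms] by (auto intro: order_trans)
next
  case False
  interpret isotropic_logconcave f L by fact
  have f0: "0 < f 0" using False by simp
  \<comment> \<open>In dimension 2 the factor of \<open>level_set_width\<close> is 33, which is less
    than 36; hence \<open>L/6\<close>.\<close>
  have ax: "(1 + 8 * 2 ^ DIM(real^2)) * (L/6)\<^sup>2 < L\<^sup>2" using L_pos by (simp add: power_divide)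
  obtain x where x: "f 0 / exp 1 \<le> f x" "L/6 < \<bar>x \<bullet> axis 1 1\<bar>"
    using level_set_wide[OF f0 _ ax, of "axis 1 1"] L_pos by auto
  have nx: "L/6 < norm x" using x(2) Cauchy_Schwarz_ineq2[of x "axis 1 1"] by simp
  then have nx0: "0 < norm x" using L_pos by linarith
  \<comment> \<open>The unit normal to \<open>x\<close>. A second point \<open>y\<close> that is
    wide in this direction spans with 0 and \<open>x\<close> a triangle of base
    \<open>norm x\<close> and height \<open>\<bar>y \<bullet> v\<bar>\<close>, both above
    \<open>L/6\<close>.\<close>
  define v :: "real^2" where "v = (1 / norm x) *\<^sub>R vector [x $ 2, - x $ 1]"
  have norm2: "(norm y)\<^sup>2 = (y $ 1)\<^sup>2 + (y $ 2)\<^sup>2" for y :: "real^2"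
    unfolding power2_norm_eq_inner inner_vec_def by (simp add: sum_2 power2_eq_square)
  have "(norm (vector [x $ 2, - x $ 1] :: real^2))\<^sup>2 = (norm x)\<^sup>2"
    unfolding norm2 by simp
  then have "norm v = 1" using nx0 by (simp add: v_def)
  then obtain y where y: "f 0 / exp 1 \<le> f y" "L/6 < \<bar>y \<bullet> v\<bar>"
    using level_set_wide[OF f0 _ ax] L_pos by auto
  have yv: "y \<bullet> v = (y $ 1 * x $ 2 - y $ 2 * x $ 1) / norm x"
    by (simp add: v_def inner_vec_def sum_2 diff_divide_distrib)
  have "convex {x. f 0 / exp 1 \<le> f x}" using f0 by (intro convex_level_set) simp
  then have sub: "convex hull {0, x, y} \<subseteq> {x. f 0 / exp 1 \<le> f x}"
    using x y f0 by (intro hull_minimal) (auto simp: divide_le_eq)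
  have cmp: "compact (convex hull {0, x, y})" by (intro finite_imp_compact_convex_hull) auto
  have "f 0 / exp 1 * measure lborel (convex hull {0, x, y}) \<le> 1"
    using sub borel_compact[OF cmp] emeasure_bounded_finite[OF compact_imp_bounded[OF cmp]]
    by (intro level_set_measure) auto
  also have "measure lborel (convex hull {0, x, y}) = \<bar>y $ 1 * x $ 2 - y $ 2 * x $ 1\<bar> / 2"
    by (subst content_triangle) (simp add: mult.commute)
  finally have 1: "f 0 * (norm x * \<bar>y \<bullet> v\<bar>) \<le> 2 * exp 1" using nx0 by (simp add: yv field_simps)
  have "f 0 * (L/6 * (L/6)) \<le> f 0 * (norm x * \<bar>y \<bullet> v\<bar>)"
    using y nx f0 L_pos by (intro mult_left_mono mult_mono) auto
  also note 1
  also have "2 * exp (1::real) \<le> 6" using exp_le by simp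
  finally have "f 0 * L\<^sup>2 \<le> 216" by (simp add: power2_eq_square)
  then show ?thesis using L_pos by (simp add: field_simps)
qed


section \<open>Marginals of isotropic convex bodies\<close>

lemma convex_body_bounded:
  assumes "convex_body n K"
  obtains M where "\<And>x. x \<in> K \<Longrightarrow> dotn n x x \<le> M"
proof -
  have K: "compactin (product_topology (\<lambda>i. euclideanreal) {..<n}) K"
    using assms by (simp add: convex_body_def topn_def)
  have "\<exists>R. \<forall>x\<in>K. \<bar>x i\<bar> \<le> R" if "i < n" for i
  proof -
    have "compact ((\<lambda>x. x i) ` K)"
      using image_compactin[OF K continuous_map_product_projection[of i]] that
      by (simp add: compactin_euclidean_iff)
    then show ?thesis
      by (auto dest!: compact_imp_bounded simp: bounded_iff)
  qed
  then obtain R where R: "\<And>i x. i < n \<Longrightarrow> x \<in> K \<Longrightarrow> \<bar>x i\<bar> \<le> R i" by metis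
  have "dotn n x x \<le> (\<Sum>i<n. (R i)\<^sup>2)" if "x \<in> K" for x
    unfolding dotn_def
  proof (rule sum_mono)
    fix i assume "i \<in> {..<n}"
    then have "\<bar>x i\<bar>\<^sup>2 \<le> (R i)\<^sup>2" using R that by (intro power_mono) auto
    then show "x i * x i \<le> (R i)\<^sup>2" by (simp add: power2_eq_square)
  qed
  then show ?thesis by (rule that)
qed

text \<open>\<open>us\<close> is a full orthonormal frame. Its first \<open>k\<close> vectors span
  the section, with coordinates indexed by numbers; the remaining ones are matched by
  \<open>e\<close> with the standard basis of the type \<open>'a\<close>, on which the marginal
  density lives.\<close>

locale marginal =
  fixes n k :: nat and us :: "(nat \<Rightarrow> real) list" and e :: "nat \<Rightarrow> 'a::euclidean_space"
  assumes us: "orthonormal n us" "length us = n" and e: "bij_betw e {k..<n} Basis" and kn: "k \<le> n"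
begin

definition glue :: "(nat \<Rightarrow> real) \<Rightarrow> 'a \<Rightarrow> nat \<Rightarrow> real" where
  "glue t z = (\<lambda>i\<in>{..<n}. if i < k then t i else z \<bullet> e i)"

definition proj :: "(nat \<Rightarrow> real) \<Rightarrow> 'a" where
  "proj x = (\<Sum>i\<in>{k..<n}. dotn n x (us ! i) *\<^sub>R e i)"

definition slice :: "(nat \<Rightarrow> real) set \<Rightarrow> 'a \<Rightarrow> (nat \<Rightarrow> real) set" where
  "slice K z = {t \<in> Rn k. comb n us (glue t z) \<in> K}"

lemma sum_Basis: "(\<Sum>i\<in>{k..<n}. g (e i)) = (\<Sum>b\<in>Basis. g b)"
  using e by (rule sum.reindex_bij_betw)

lemma glue_Rn [simp]: "glue t z \<in> Rn n" by (simp add: glue_def)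

lemma proj_comb_glue: "proj (comb n us (glue t z)) = z"
proof -
  have "proj (comb n us (glue t z)) = (\<Sum>i\<in>{k..<n}. (z \<bullet> e i) *\<^sub>R e i)"
    unfolding proj_def using us by (intro sum.cong refl) (simp add: dotn_comb_nth glue_def)
  also have "\<dots> = z" unfolding sum_Basis[of "\<lambda>b. (z \<bullet> b) *\<^sub>R b"] by (rule euclidean_representation)
  finally show ?thesis .
qed

lemma comb_glue_lincomb:
  "lincomb n a (comb n us (glue s x)) b (comb n us (glue t y)) = comb n us (glue (lincomb k a s b t) (a *\<^sub>R x + b *\<^sub>R y))"
  using us by (auto simp: lincomb_def comb_def glue_def fun_eq_iff sum_distrib_left sum.distrib[symmetric]
      algebra_simps inner_add_left intro!: sum.cong)

lemma measurable_glue: "(\<lambda>(z, t). glue t z) \<in> borel \<Otimes>\<^sub>M lebn k \<rightarrow>\<^sub>M lebn n"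
proof (rule measurable_lebnI)
  fix i assume i: "i < n"
  show "(\<lambda>x. (case x of (z, t) \<Rightarrow> glue t z) i) \<in> borel_measurable (borel \<Otimes>\<^sub>M lebn k)"
  proof (cases "i < k")
    case True
    have "(\<lambda>x. snd x i) \<in> borel_measurable (borel \<Otimes>\<^sub>M lebn k)"
      by (rule measurable_lebnD[OF measurable_snd True])
    then show ?thesis using True i by (simp add: glue_def case_prod_unfold)
  next
    case False
    then show ?thesis using i by (simp add: glue_def case_prod_unfold)
  qed
qed auto

lemma measurable_glue1: "(\<lambda>t. glue t z) \<in> lebn k \<rightarrow>\<^sub>M lebn n"
  using measurable_compose[OF measurable_Pair1'[of z borel "lebn k"] measurable_glue] by simp

lemma measurable_comb_us: "comb n us \<in> lebn n \<rightarrow>\<^sub>M lebn n"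
  using measurable_comb[of "\<lambda>x. x" "lebn n" us n] us by simp

lemma nn_integral_comb:
  assumes "\<phi> \<in> borel_measurable (lebn n)"
  shows "(\<integral>\<^sup>+ x. \<phi> (comb n us x) \<partial>lebn n) = integral\<^sup>N (lebn n) \<phi>"
  using nn_integral_distr[OF measurable_comb_us, of \<phi>] assms distr_lebn_orthogonal[OF us] by simp

text \<open>Passage between Lebesgue measure on the type \<open>'a\<close> and the indexed product
  measure, checked on boxes.\<close>

lemma distr_lborel_coordinates:
  "distr (lborel :: 'a measure) (\<Pi>\<^sub>M i\<in>{k..<n}. lborel) (\<lambda>z. \<lambda>i\<in>{k..<n}. z \<bullet> e i) = (\<Pi>\<^sub>M i\<in>{k..<n}. lborel)"
proof -
  interpret product_sigma_finite "\<lambda>_::nat. lborel :: real measure" ..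
  have m: "(\<lambda>z. \<lambda>i\<in>{k..<n}. z \<bullet> e i) \<in> (lborel :: 'a measure) \<rightarrow>\<^sub>M (\<Pi>\<^sub>M i\<in>{k..<n}. lborel)"
    by (intro measurable_restrict) auto
  define e' where "e' = inv_into {k..<n} e"
  have e'e: "e' (e i) = i" if "i \<in> {k..<n}" for i
    using e that by (simp add: e'_def bij_betw_inv_into_left)
  have e'_bij: "bij_betw e' Basis {k..<n}" unfolding e'_def by (rule bij_betw_inv_into[OF e])
  show ?thesis
  proof (rule PiM_eqI)
    fix A :: "nat \<Rightarrow> real set" assume A: "\<And>i. i \<in> {k..<n} \<Longrightarrow> A i \<in> sets lborel"
    have A': "A (e' b) \<in> sets borel" if "b \<in> Basis" for b
      using A[of "e' b"] bij_betwE[OF e'_bij] that by simp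
    have "emeasure (distr lborel (\<Pi>\<^sub>M i\<in>{k..<n}. lborel) (\<lambda>z::'a. \<lambda>i\<in>{k..<n}. z \<bullet> e i)) (Pi\<^sub>E {k..<n} A)
        = (\<integral>\<^sup>+ x. indicator (Pi\<^sub>E {k..<n} A) x \<partial>distr lborel (\<Pi>\<^sub>M i\<in>{k..<n}. lborel) (\<lambda>z::'a. \<lambda>i\<in>{k..<n}. z \<bullet> e i))"
      using A by (subst nn_integral_indicator) (auto intro!: sets_PiM_I_finite)
    also have "\<dots> = (\<integral>\<^sup>+ z. indicator (Pi\<^sub>E {k..<n} A) (\<lambda>i\<in>{k..<n}. z \<bullet> e i) \<partial>(lborel :: 'a measure))"
      using A m by (intro nn_integral_distr) (auto intro!: borel_measurable_indicator sets_PiM_I_finite)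
    also have "\<dots> = (\<integral>\<^sup>+ z. (\<Prod>b\<in>Basis. indicator (A (e' b)) (z \<bullet> b)) \<partial>(lborel :: 'a measure))"
    proof (rule nn_integral_cong)
      fix z :: 'a
      have "(\<Prod>b\<in>Basis. indicator (A (e' b)) (z \<bullet> b)) = (\<Prod>i\<in>{k..<n}. indicator (A i) (z \<bullet> e i) :: ennreal)"
        using prod.reindex_bij_betw[OF e, of "\<lambda>b. indicator (A (e' b)) (z \<bullet> b) :: ennreal"] e'e by simp
      also have "\<dots> = indicator (Pi\<^sub>E {k..<n} A) (\<lambda>i\<in>{k..<n}. z \<bullet> e i)"
        by (auto simp: indicator_def PiE_iff prod_eq_1_iff intro!: prod.neutral)
      finally show "indicator (Pi\<^sub>E {k..<n} A) (\<lambda>i\<in>{k..<n}. z \<bullet> e i) = (\<Prod>b\<in>Basis. indicator (A (e' b)) (z \<bullet> b) :: ennreal)"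
        by simp
    qed
    also have "\<dots> = (\<Prod>b\<in>(Basis::'a set). \<integral>\<^sup>+ x. indicator (A (e' b)) x \<partial>lborel)"
      using A' by (intro nn_integral_lborel_prod) auto
    also have "\<dots> = (\<Prod>b\<in>(Basis::'a set). emeasure lborel (A (e' b)))"
      using A' by (intro prod.cong) auto
    also have "\<dots> = (\<Prod>i\<in>{k..<n}. emeasure lborel (A i))"
      by (rule prod.reindex_bij_betw[OF e'_bij])
    finally show "emeasure (distr lborel (\<Pi>\<^sub>M i\<in>{k..<n}. lborel) (\<lambda>z::'a. \<lambda>i\<in>{k..<n}. z \<bullet> e i)) (Pi\<^sub>E {k..<n} A)
        = (\<Prod>i\<in>{k..<n}. emeasure lborel (A i))" .
  qed simp_all
qed

lemma nn_integral_lebn_glue: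
  assumes \<phi>: "\<phi> \<in> borel_measurable (lebn n)"
  shows "integral\<^sup>N (lebn n) \<phi> = (\<integral>\<^sup>+ z. (\<integral>\<^sup>+ t. \<phi> (glue t z) \<partial>lebn k) \<partial>lborel)"
proof -
  interpret product_sigma_finite "\<lambda>_::nat. lborel :: real measure" ..
  interpret sigma_finite_measure "lebn k" by (rule sigma_finite_lebn)
  have un: "{..<n} = {k..<n} \<union> {..<k}" using kn by auto
  have merge: "merge {k..<n} {..<k} (\<lambda>i\<in>{k..<n}. z \<bullet> e i, t) = glue t z" for t and z :: 'a
    using kn by (auto simp: merge_def glue_def fun_eq_iff)
  have mg: "(\<lambda>(x, t). \<phi> (merge {k..<n} {..<k} (x, t))) \<in> borel_measurable ((\<Pi>\<^sub>M i\<in>{k..<n}. lborel) \<Otimes>\<^sub>M lebn k)"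
    using measurable_compose[OF measurable_merge[of "{k..<n}" "{..<k}" "\<lambda>_. lborel"], of \<phi>] \<phi>
    by (simp add: lebn_def un case_prod_unfold)
  have "integral\<^sup>N (lebn n) \<phi> = (\<integral>\<^sup>+ x. (\<integral>\<^sup>+ t. \<phi> (merge {k..<n} {..<k} (x, t)) \<partial>lebn k) \<partial>(\<Pi>\<^sub>M i\<in>{k..<n}. lborel))"
    unfolding lebn_def un using \<phi> by (intro product_nn_integral_fold) (auto simp: lebn_def un)
  also have "\<dots> = (\<integral>\<^sup>+ z. (\<integral>\<^sup>+ t. \<phi> (merge {k..<n} {..<k} (\<lambda>i\<in>{k..<n}. z \<bullet> e i, t)) \<partial>lebn k) \<partial>(lborel :: 'a measure))"
    by (subst distr_lborel_coordinates[symmetric], rule nn_integral_distr)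
       (use borel_measurable_nn_integral[OF mg] in \<open>auto intro!: measurable_restrict\<close>)
  finally show ?thesis unfolding merge .
qed

lemma slice_measurable:
  assumes "K \<in> sets (lebn n)"
  shows "slice K z \<in> sets (lebn k)"
proof -
  have "slice K z = (\<lambda>t. comb n us (glue t z)) -` K \<inter> space (lebn k)"
    by (auto simp: slice_def space_lebn)
  then show ?thesis
    using measurable_sets[OF measurable_compose[OF measurable_glue1 measurable_comb_us] assms] by simp
qed

lemma slice_measure_measurable:
  assumes K: "K \<in> sets (lebn n)"
  shows "(\<lambda>z. emeasure (lebn k) (slice K z)) \<in> borel_measurable borel"
proof -
  interpret sigma_finite_measure "lebn k" by (rule sigma_finite_lebn)
  have "(\<lambda>(z, t). indicator K (comb n us (glue t z)) :: ennreal) \<in> borel_measurable (borel \<Otimes>\<^sub>M lebn k)"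
    using measurable_compose[OF measurable_compose[OF measurable_glue measurable_comb_us] borel_measurable_indicator[OF K]]
    by (simp add: case_prod_unfold)
  from borel_measurable_nn_integral[OF this]
  have "(\<lambda>z. \<integral>\<^sup>+ t. indicator K (comb n us (glue t z)) \<partial>lebn k) \<in> borel_measurable borel" .
  also have "(\<lambda>z. \<integral>\<^sup>+ t. indicator K (comb n us (glue t z)) \<partial>lebn k) = (\<lambda>z. \<integral>\<^sup>+ t. indicator (slice K z) t \<partial>lebn k)"
    by (intro ext nn_integral_cong) (auto simp: indicator_def slice_def space_lebn)
  finally show ?thesis using slice_measurable[OF K] by simp
qed

lemma proj_measurable: "proj \<in> lebn n \<rightarrow>\<^sub>M borel"
proof -
  have "(\<lambda>x. dotn n x (us ! i)) \<in> borel_measurable (lebn n)" if "i < n" for i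
    using that us orthonormal_nth[OF us(1), of i] by (intro measurable_dotn) (auto simp: space_lebn)
  then show ?thesis unfolding proj_def[abs_def] by (intro borel_measurable_sum borel_measurable_scaleR) auto
qed

text \<open>Rotate into the frame \<open>us\<close> and apply Fubini: the slice volume is the
  density of the projection of the volume of \<open>K\<close>. This turns integrals over
  \<open>K\<close> into integrals of the marginal.\<close>

lemma distr_proj:
  assumes K: "K \<in> sets (lebn n)"
  shows "distr (density (lebn n) (indicator K)) borel proj
    = density lborel (\<lambda>z. emeasure (lebn k) (slice K z))"
proof (rule measure_eqI)
  fix A assume "A \<in> sets (distr (density (lebn n) (indicator K)) borel proj)"
  then have A: "A \<in> sets borel" by simp
  let ?\<phi> = "\<lambda>x. indicator K x * indicator A (proj x) :: ennreal"
  have [measurable]: "?\<phi> \<in> borel_measurable (lebn n)"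
    using K A measurable_compose[OF proj_measurable borel_measurable_indicator[OF A]] by measurable
  have "emeasure (distr (density (lebn n) (indicator K)) borel proj) A = integral\<^sup>N (lebn n) ?\<phi>"
    using A K proj_measurable
    by (subst emeasure_distr, simp, simp, subst emeasure_density)
       (auto intro!: nn_integral_cong measurable_sets[OF proj_measurable] simp: indicator_def)
  also have "\<dots> = (\<integral>\<^sup>+ x. ?\<phi> (comb n us x) \<partial>lebn n)" by (rule nn_integral_comb[symmetric]) measurable
  also have "\<dots> = (\<integral>\<^sup>+ z. (\<integral>\<^sup>+ t. ?\<phi> (comb n us (glue t z)) \<partial>lebn k) \<partial>lborel)"
    by (rule nn_integral_lebn_glue) (rule measurable_compose[OF measurable_comb_us], measurable)
  also have "\<dots> = (\<integral>\<^sup>+ z. emeasure (lebn k) (slice K z) * indicator A z \<partial>lborel)"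
  proof (rule nn_integral_cong)
    fix z :: 'a
    have "(\<integral>\<^sup>+ t. ?\<phi> (comb n us (glue t z)) \<partial>lebn k) = (\<integral>\<^sup>+ t. indicator (slice K z) t * indicator A z \<partial>lebn k)"
      by (intro nn_integral_cong) (auto simp: indicator_def slice_def space_lebn proj_comb_glue)
    also have "\<dots> = emeasure (lebn k) (slice K z) * indicator A z"
      using slice_measurable[OF K] by (subst nn_integral_multc) auto
    finally show "(\<integral>\<^sup>+ t. ?\<phi> (comb n us (glue t z)) \<partial>lebn k) = emeasure (lebn k) (slice K z) * indicator A z" .
  qed
  also have "\<dots> = emeasure (density lborel (\<lambda>z. emeasure (lebn k) (slice K z))) A"
    using A slice_measure_measurable[OF K] by (subst emeasure_density) auto
  finally show "emeasure (distr (density (lebn n) (indicator K)) borel proj) A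
      = emeasure (density lborel (\<lambda>z. emeasure (lebn k) (slice K z))) A" .
qed simp

lemma emeasure_slice_finite:
  assumes "convex_body n K"
  shows "emeasure (lebn k) (slice K z) < top"
proof -
  obtain M where M: "\<And>x. x \<in> K \<Longrightarrow> dotn n x x \<le> M" using convex_body_bounded[OF assms] by blast
  \<comment> \<open>The extra 1 makes the coordinate bounds strict, to fit an open box.\<close>
  define R where "R = sqrt (M + 1)"
  have "slice K z \<subseteq> Pi\<^sub>E {..<k} (\<lambda>i. {-R<..<R})"
  proof
    fix t assume t: "t \<in> slice K z"
    have "- R < t j \<and> t j < R" if "j < k" for j
    proof -
      have "(t j)\<^sup>2 = glue t z j * glue t z j" using that kn by (simp add: glue_def power2_eq_square)
      also have "\<dots> \<le> dotn n (glue t z) (glue t z)"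
        unfolding dotn_def using that kn by (intro member_le_sum) auto
      also have "\<dots> = dotn n (comb n us (glue t z)) (comb n us (glue t z))"
        using dotn_comb_comb[OF us(1)] us(2) by simp
      also have "\<dots> \<le> M" using t by (intro M) (simp add: slice_def)
      finally have "(t j)\<^sup>2 < M + 1" by simp
      then have "sqrt ((t j)\<^sup>2) < R" unfolding R_def by (subst real_sqrt_less_iff)
      then show ?thesis by (simp add: abs_less_iff)
    qed
    then show "t \<in> Pi\<^sub>E {..<k} (\<lambda>i. {-R<..<R})" using t by (auto simp: slice_def Rn_def PiE_iff)
  qed
  moreover have "Pi\<^sub>E {..<k} (\<lambda>i. {-R<..<R}) \<in> sets (lebn k)"
    unfolding lebn_def by (intro sets_PiM_I_finite) auto
  ultimately have "emeasure (lebn k) (slice K z) \<le> emeasure (lebn k) (Pi\<^sub>E {..<k} (\<lambda>i. {-R<..<R}))"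
    by (rule emeasure_mono)
  also have "\<dots> < top" unfolding emeasure_lebn_box by (simp add: power_less_top_ennreal)
  finally show ?thesis .
qed

text \<open>By convexity of \<open>K\<close>, convex combinations of points of two slices lie in the
  intermediate slice; Prekopa-Leindler is applied to the indicators of the three slices.\<close>

lemma slice_logconcave:
  assumes K: "convex_body n K" "K \<in> sets (lebn n)" and t: "0 < t" "t < 1"
  shows "measure (lebn k) (slice K x) powr (1 - t) * measure (lebn k) (slice K y) powr t
    \<le> measure (lebn k) (slice K ((1 - t) *\<^sub>R x + t *\<^sub>R y))"
proof -
  let ?z = "(1 - t) *\<^sub>R x + t *\<^sub>R y"
  define F where "F z = measure (lebn k) (slice K z)" for z
  have F: "emeasure (lebn k) (slice K z) = ennreal (F z)" for z
    unfolding F_def using emeasure_slice_finite[OF K(1), of z] by (intro emeasure_eq_ennreal_measure) auto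
  have int: "integral\<^sup>N (lebn k) (indicator (slice K z)) = ennreal (F z)" for z
    using slice_measurable[OF K(2)] by (simp add: F)
  show ?thesis
  proof (cases "F x = 0 \<or> F y = 0")
    case True
    then show ?thesis by (auto simp: F_def)
  next
    case False
    then have pos: "0 < F x" "0 < F y" by (auto simp: F_def zero_less_measure_iff)
    have conv: "lincomb k (1 - t) a t b \<in> slice K ?z" if ab: "a \<in> slice K x" "b \<in> slice K y" for a b
    proof -
      have "lincomb n (1 - t) (comb n us (glue a x)) t (comb n us (glue b y)) \<in> K"
        using K(1) ab t by (auto simp: convex_body_def slice_def)
      then show ?thesis by (simp add: slice_def comb_glue_lincomb)
    qed
    have "F x powr (1 - t) * F y powr t \<le> F ?z"
    \<comment> \<open>\<open>prekopa_leindler\<close> takes strict lower bounds of the integrals, so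
      both volumes are shrunk by a factor \<open>r < 1\<close>, which comes out of the geometric
      mean unchanged.\<close>
    proof (rule field_le_mult_one_interval)
      fix r :: real assume r: "0 < r" "r < 1"
      have "ennreal ((r * F x) powr (1 - t) * (r * F y) powr t) \<le> integral\<^sup>N (lebn k) (indicator (slice K ?z))"
      proof (rule prekopa_leindler[OF _ _ _ t])
        show "ennreal (r * F x) < integral\<^sup>N (lebn k) (indicator (slice K x))"
          "ennreal (r * F y) < integral\<^sup>N (lebn k) (indicator (slice K y))"
          unfolding int using r pos by (simp_all add: ennreal_less_iff)
        fix a b and c d :: real
        assume cd: "0 < c" "0 < d" "ennreal c < indicator (slice K x) a" "ennreal d < indicator (slice K y) b"
        have ab: "a \<in> slice K x" "b \<in> slice K y"
          using cd by (cases "a \<in> slice K x"; cases "b \<in> slice K y"; simp)+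
        with cd have "c < 1" "d < 1" by (auto simp: ennreal_less_one_iff)
        then have "c powr (1 - t) * d powr t \<le> 1 * 1"
          using cd t by (intro mult_mono powr_le1) auto
        then show "ennreal (c powr (1 - t) * d powr t) \<le> indicator (slice K ?z) (lincomb k (1 - t) a t b)"
          using conv[OF ab] by (simp add: ennreal_le_1)
      qed (use r pos slice_measurable[OF K(2)] in auto)
      then have "(r * F x) powr (1 - t) * (r * F y) powr t \<le> F ?z"
        unfolding int by (subst (asm) ennreal_le_iff) (auto simp: F_def)
      also have "(r * F x) powr (1 - t) * (r * F y) powr t = (r powr (1 - t) * r powr t) * (F x powr (1 - t) * F y powr t)"
        using r pos by (simp add: powr_mult)
      also have "r powr (1 - t) * r powr t = r" using r by (simp add: powr_add[symmetric])
      finally show "r * (F x powr (1 - t) * F y powr t) \<le> F ?z" .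
    qed
    then show ?thesis by (simp add: F_def)
  qed
qed

text \<open>\<open>v\<close> is the image of \<open>u\<close> under the adjoint of
  \<open>proj\<close>, an isometric embedding; moments of the marginal in direction \<open>u\<close>
  are moments of \<open>K\<close> in direction \<open>v\<close>.\<close>

lemma proj_inner:
  obtains v where "v \<in> Rn n" "dotn n v v = (norm u)\<^sup>2" "\<And>x. proj x \<bullet> u = dotn n x v"
proof -
  define s where "s i = (if k \<le> i then e i \<bullet> u else 0)" for i
  have sum: "(\<Sum>i<n. if k \<le> i then g i else 0) = (\<Sum>i\<in>{k..<n}. g i :: real)" for g
    using kn by (subst sum.If_cases) (auto intro!: sum.cong)
  have "dotn n (comb n us s) (comb n us s) = dotn n s s"
    using dotn_comb_comb[OF us(1)] us(2) by simp
  also have "\<dots> = (\<Sum>i<n. if k \<le> i then (e i \<bullet> u) * (e i \<bullet> u) else 0)"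
    unfolding dotn_def by (intro sum.cong) (auto simp: s_def)
  also have "\<dots> = (\<Sum>b\<in>Basis. (b \<bullet> u) * (b \<bullet> u))"
    unfolding sum by (rule sum_Basis[of "\<lambda>b. (b \<bullet> u) * (b \<bullet> u)"])
  also have "\<dots> = (norm u)\<^sup>2"
    by (subst power2_norm_eq_inner, subst euclidean_inner) (simp add: inner_commute)
  finally have 1: "dotn n (comb n us s) (comb n us s) = (norm u)\<^sup>2" .
  have "proj x \<bullet> u = dotn n x (comb n us s)" for x
  proof -
    have "dotn n x (comb n us s) = (\<Sum>i<n. s i * dotn n x (us ! i))"
      using us(2) by (subst dotn_commute, subst dotn_comb_left) (simp add: dotn_commute[of n x])
    also have "\<dots> = (\<Sum>i<n. if k \<le> i then (e i \<bullet> u) * dotn n x (us ! i) else 0)"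
      by (intro sum.cong) (auto simp: s_def)
    also have "\<dots> = proj x \<bullet> u" unfolding sum proj_def by (simp add: inner_sum_left mult.commute)
    finally show ?thesis by simp
  qed
  with 1 show ?thesis by (intro that) auto
qed

theorem isotropic_logconcave_slice:
  assumes K: "isotropic n K" and L: "is_isotropic_constant n K L"
  shows "isotropic_logconcave (\<lambda>z. measure (lebn k) (slice K z)) L"
proof -
  define F where "F z = measure (lebn k) (slice K z)" for z
  have cb: "convex_body n K" and vol: "measure (lebn n) K = 1" and cen: "centered n K"
    using K by (auto simp: isotropic_def)
  \<comment> \<open>\<open>measure\<close> is 0 on nonmeasurable sets and on sets of infinite
    measure, so volume 1 yields both measurability and finiteness.\<close>
  have Ks: "K \<in> sets (lebn n)" using vol by (metis measure_notin_sets zero_neq_one)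
  have em: "emeasure (lebn n) K = 1"
    using vol by (metis emeasure_eq_ennreal_measure ennreal_1 measure_zero_top zero_neq_one)
  have F: "emeasure (lebn k) (slice K z) = ennreal (F z)" for z
    unfolding F_def using emeasure_slice_finite[OF cb, of z] by (intro emeasure_eq_ennreal_measure) auto
  have Fm: "F \<in> borel_measurable borel"
    unfolding F_def measure_def using slice_measure_measurable[OF Ks] by measurable
  have F0: "0 \<le> F z" for z by (simp add: F_def)
  have Lpos: "0 < L" using L by (simp add: is_isotropic_constant_def)
  have dm: "(\<lambda>x. dotn n x v) \<in> borel_measurable (lebn n)" if "v \<in> Rn n" for v
    using that by (intro measurable_dotn) (auto simp: space_lebn)
  have transfer: "has_bochner_integral lborel (\<lambda>z. h z * F z) c"
    if h: "h \<in> borel_measurable borel" and c: "has_bochner_integral (lebn n) (\<lambda>x. indicator K x *\<^sub>R h (proj x)) c"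
    for h c
  proof -
    have hp: "(\<lambda>x. h (proj x)) \<in> borel_measurable (lebn n)" by (rule measurable_compose[OF proj_measurable h])
    have ind: "(\<lambda>x. ennreal (indicator K x)) = (indicator K :: _ \<Rightarrow> ennreal)" by (simp add: ennreal_indicator)
    have "has_bochner_integral (density (lebn n) (indicator K)) (\<lambda>x. h (proj x)) c"
      using has_bochner_integral_density[OF hp _ _ c] Ks unfolding ind by simp
    then have "has_bochner_integral (distr (density (lebn n) (indicator K)) borel proj) h c"
      using h proj_measurable by (simp add: has_bochner_integral_iff integrable_distr_eq integral_distr)
    then have "has_bochner_integral (density lborel (\<lambda>z. ennreal (F z))) h c"
      unfolding distr_proj[OF Ks] F .
    then show ?thesis
      using h Fm F0 by (simp add: has_bochner_integral_iff integrable_density integral_density mult.commute)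
  qed
  have Kint: "has_bochner_integral (lebn n) (\<lambda>x. indicator K x *\<^sub>R 1) (1::real)"
    using has_bochner_integral_real_indicator[OF Ks] em vol by simp
  have sq: "has_bochner_integral (lebn n) (\<lambda>x. indicator K x *\<^sub>R (dotn n x v)\<^sup>2) (L\<^sup>2)"
    if "v \<in> Rn n" "dotn n v v = 1" for v
  proof -
    have "(LINT x|lebn n. indicator K x *\<^sub>R (dotn n x v)\<^sup>2) = L\<^sup>2"
      using L that by (auto simp: is_isotropic_constant_def unit_sphere_def set_lebesgue_integral_def)
    \<comment> \<open>The Bochner integral of a nonintegrable function is 0, whereas this one is
      positive.\<close>
    moreover from this have "integrable (lebn n) (\<lambda>x. indicator K x *\<^sub>R (dotn n x v)\<^sup>2)"
      using Lpos by (metis not_integrable_integral_eq power_eq_0_iff less_irrefl)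
    ultimately show ?thesis by (simp add: has_bochner_integral_iff)
  qed
  have coord: "has_bochner_integral (lebn n) (\<lambda>x. indicator K x *\<^sub>R x i) 0" if i: "i < n" for i
  proof -
    let ?v = "\<lambda>k\<in>{..<n}. if k = i then 1 else 0 :: real"
    have dv: "dotn n x ?v = x i" for x using i by (subst dotn_commute) (rule dotn_unit)
    have "has_bochner_integral (lebn n) (\<lambda>x. indicator K x *\<^sub>R (x i)\<^sup>2) (L\<^sup>2)"
      using sq[of ?v] i unfolding dv by simp
    then have int: "integrable (lebn n) (\<lambda>x. indicator K x *\<^sub>R 1 + indicator K x *\<^sub>R (x i)\<^sup>2 :: real)"
      using Kint by (intro Bochner_Integration.integrable_add) (auto simp: has_bochner_integral_iff)
    have "integrable (lebn n) (\<lambda>x. indicator K x *\<^sub>R x i)"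
    proof (rule Bochner_Integration.integrable_bound[OF int])
      show "(\<lambda>x. indicator K x *\<^sub>R x i) \<in> borel_measurable (lebn n)"
        using Ks measurable_component_lebn[OF i] by measurable
      \<comment> \<open>Integrability of the coordinates, which the default value 0 of the
        barycenter integral cannot supply, comes from the second moment.\<close>
      have "\<bar>y\<bar> \<le> 1 + y\<^sup>2" for y :: real
        using zero_le_power2[of "\<bar>y\<bar> - 1"] by (simp add: power2_diff)
      then show "AE x in lebn n. norm (indicator K x *\<^sub>R x i) \<le> norm (indicator K x *\<^sub>R 1 + indicator K x *\<^sub>R (x i)\<^sup>2 :: real)"
        by (auto simp: indicator_def)
    qed
    moreover have "(LINT x|lebn n. indicator K x *\<^sub>R x i) = 0"
    proof -
      have "barycenter n K i = 0" using cen i by (simp add: centered_def)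
      then show ?thesis using i vol by (simp add: barycenter_def set_lebesgue_integral_def)
    qed
    ultimately show ?thesis by (simp add: has_bochner_integral_iff)
  qed
  have lin: "has_bochner_integral (lebn n) (\<lambda>x. indicator K x *\<^sub>R dotn n x v) 0" for v
  proof -
    have "has_bochner_integral (lebn n) (\<lambda>x. \<Sum>i<n. (indicator K x *\<^sub>R x i) * v i) (\<Sum>i<n. 0 * v i)"
      by (intro has_bochner_integral_sum has_bochner_integral_mult_left coord) auto
    then show ?thesis by (simp add: dotn_def sum_distrib_left mult.assoc)
  qed
  have "isotropic_logconcave F L"
  proof
    show "0 < L" by fact
    show "0 \<le> F x" for x by (rule F0)
    show "has_bochner_integral lborel F 1" using transfer[of "\<lambda>_. 1" 1] Kint by simp
    fix u :: 'a
    obtain v where v: "v \<in> Rn n" "dotn n v v = (norm u)\<^sup>2" "\<And>x. proj x \<bullet> u = dotn n x v"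
      by (rule proj_inner[of u]) blast
    show "has_bochner_integral lborel (\<lambda>x. (x \<bullet> u) * F x) 0"
      by (rule transfer) (use lin v in auto)
    show "has_bochner_integral lborel (\<lambda>x. (x \<bullet> u)\<^sup>2 * F x) (L\<^sup>2)" if "norm u = 1"
      by (rule transfer) (use sq v that in auto)
  next
    show "F x powr (1 - t) * F y powr t \<le> F ((1 - t) *\<^sub>R x + t *\<^sub>R y)" if "0 < t" "t < 1" for x y t
      unfolding F_def using slice_logconcave[OF cb Ks that] .
  qed
  then show ?thesis by (simp add: F_def[abs_def])
qed

lemma slice_0:
  assumes us: "us = vs @ ws" "length vs = k"
  shows "slice K 0 = {t \<in> Rn k. comb n vs t \<in> K}"
proof -
  have "comb n us (glue t 0) = comb n vs t" for t
  proof -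
    have n: "n = k + length ws" using marginal.us(2)[OF marginal_axioms] us by simp
    have "(\<Sum>j<n. glue t 0 j * (us ! j) i) = (\<Sum>j<k. t j * (vs ! j) i)" for i
    proof (rule sum.mono_neutral_cong_right)
      show "\<forall>j\<in>{..<n} - {..<k}. glue t 0 j * (us ! j) i = 0" by (auto simp: glue_def)
      show "glue t 0 j * (us ! j) i = t j * (vs ! j) i" if "j \<in> {..<k}" for j
        using that kn by (simp add: glue_def us nth_append)
    qed (use kn in auto)
    then show ?thesis using us n by (simp add: comb_def)
  qed
  then show ?thesis by (simp add: slice_def)
qed

end


section \<open>Volumes of central sections\<close>

text \<open>Hands out the very basis that \<open>SOME\<close> picks in \<open>subspace_vol\<close>;
  it is then completed to a frame of the whole space instead of being compared with other
  bases.\<close>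

lemma subspace_vol_eq_slice:
  assumes E: "linear_subspace n E"
  obtains us where "orthonormal_basis n us E"
    "\<And>K. subspace_vol n E (K \<inter> E) = emeasure (lebn (length us)) {t \<in> Rn (length us). comb n us t \<in> K}"
proof -
  define us where "us = (SOME us. orthonormal_basis n us E)"
  have us: "orthonormal_basis n us E"
    unfolding us_def using exists_orthonormal_basis[OF E] by (metis someI_ex)
  then have "comb n us t \<in> K \<inter> E \<longleftrightarrow> comb n us t \<in> K" for t K by (auto simp: orthonormal_basis_iff)
  then have "subspace_vol n E (K \<inter> E) = emeasure (lebn (length us)) {t \<in> Rn (length us). comb n us t \<in> K}" for K
    by (simp add: subspace_vol_def us_def[symmetric] Let_def comb_def)
  with us show ?thesis by (rule that)
qed

lemma linear_subspace_perp: "linear_subspace n (perp n v)"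
  using linear_subspace_Int_perp[OF linear_subspace_Rn, of n v] by (simp only: perp_eq[symmetric])

lemma orthonormal_basis_perp_append:
  assumes "orthonormal_basis n us (perp n v)" "v \<in> unit_sphere n (Rn n)"
  shows "orthonormal_basis n (us @ [v]) (Rn n)"
  using orthonormal_basis_append[OF linear_subspace_Rn _ assms(2)] assms(1) by (simp only: perp_eq[symmetric])

lemma unit_sphere_nonempty:
  assumes us: "orthonormal_basis n us E" "0 < length us"
  shows "unit_sphere n E \<noteq> {}"
proof -
  let ?e = "\<lambda>j\<in>{..<length us}. if j = 0 then 1 else 0 :: real"
  have o: "orthonormal n us" and E: "E = range (comb n us)" using us by (auto simp: orthonormal_basis_iff)
  have "dotn n (comb n us ?e) (comb n us ?e) = 1"
    unfolding dotn_comb_comb[OF o] using us(2) by (simp add: dotn_unit)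
  then have "comb n us ?e \<in> unit_sphere n E" by (auto simp: unit_sphere_def E)
  then show ?thesis by blast
qed

lemma unit_sphere_Rn_nonempty: "0 < n \<Longrightarrow> unit_sphere n (Rn n) \<noteq> {}"
  using exists_orthonormal_basis[OF linear_subspace_Rn] orthonormal_basis_Rn_iff unit_sphere_nonempty by metis

text \<open>Here \<open>2 \<le> n\<close> enters: the hyperplane has dimension \<open>n - 1\<close>,
  hence contains a unit vector.\<close>

lemma unit_sphere_perp_nonempty:
  assumes n: "2 \<le> n" and v: "v \<in> unit_sphere n (Rn n)"
  shows "unit_sphere n (perp n v) \<noteq> {}"
proof -
  obtain us where us: "orthonormal_basis n us (perp n v)"
    using exists_orthonormal_basis[OF linear_subspace_perp] .
  have "length (us @ [v]) = n"
    using orthonormal_basis_perp_append[OF us v] orthonormal_basis_Rn_iff by blast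
  with us n show ?thesis by (intro unit_sphere_nonempty) auto
qed

text \<open>The complement of the section is one-dimensional, so the exponent
  \<open>1 - DIM('a) - C\<close> of \<open>lower_bound_0\<close> becomes \<open>- C\<close>.\<close>

lemma hyperplane_section_bounds:
  assumes K: "isotropic n K" "is_isotropic_constant n K L" and v: "v \<in> unit_sphere n (Rn n)"
  shows "ennreal (exp (- (\<integral>x. exp (- (norm (x::real))\<^sup>2) \<partial>lborel)) / L) \<le> subspace_vol n (perp n v) (K \<inter> perp n v)
    \<and> subspace_vol n (perp n v) (K \<inter> perp n v) \<le> ennreal (30 / L)"
proof -
  obtain us where us: "orthonormal_basis n us (perp n v)"
    and vol: "\<And>K. subspace_vol n (perp n v) (K \<inter> perp n v) = emeasure (lebn (length us)) {t \<in> Rn (length us). comb n us t \<in> K}"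
    by (rule subspace_vol_eq_slice[OF linear_subspace_perp[of n v]]) blast
  have b: "orthonormal n (us @ [v])" "length (us @ [v]) = n"
    using orthonormal_basis_perp_append[OF us v] orthonormal_basis_Rn_iff by blast+
  then have n: "n = Suc (length us)" by simp
  interpret marginal n "length us" "us @ [v]" "\<lambda>_. 1 :: real"
    using b by unfold_locales (auto simp: n bij_betw_def)
  interpret iso: isotropic_logconcave "\<lambda>z. measure (lebn (length us)) (slice K z)" L
    by (rule isotropic_logconcave_slice[OF K])
  have cb: "convex_body n K" using K by (simp add: isotropic_def)
  have "subspace_vol n (perp n v) (K \<inter> perp n v) = ennreal (measure (lebn (length us)) (slice K 0))"
    unfolding vol slice_0[OF refl refl, symmetric]
    using emeasure_slice_finite[OF cb, of 0] by (intro emeasure_eq_ennreal_measure) auto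
  then show ?thesis
    using iso.lower_bound_0 upper_bound_real[OF iso.isotropic_logconcave_axioms] by (auto intro!: ennreal_leI)
qed

lemma bij_betw_axis_2: "bij_betw (\<lambda>i. axis (if i = k then 1 else 2) 1 :: real ^ 2) {k..<Suc (Suc k)} Basis"
proof -
  have "{k..<Suc (Suc k)} = {k, Suc k}" by auto
  moreover have "(Basis :: (real ^ 2) set) = {axis 1 1, axis 2 1}"
    by (auto simp: Basis_vec_def UNIV_2)
  ultimately show ?thesis by (auto simp: bij_betw_def axis_eq_axis)
qed

text \<open>As \<open>w\<close> is orthogonal to \<open>v\<close>, appending both completes a basis
  of the section, and the exponent is \<open>1 - 2 - C\<close>. For \<open>n = 2\<close> the section
  is a point and \<open>us\<close> is empty.\<close>

lemma codim_2_section_bounds: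
  assumes K: "isotropic n K" "is_isotropic_constant n K L" and v: "v \<in> unit_sphere n (Rn n)"
    and w: "w \<in> unit_sphere n (perp n v)"
  shows "ennreal (exp (- 1 - (\<integral>x. exp (- (norm (x::real ^ 2))\<^sup>2) \<partial>lborel)) / L\<^sup>2)
      \<le> subspace_vol n (perp n v \<inter> perp n w) (K \<inter> (perp n v \<inter> perp n w))
    \<and> subspace_vol n (perp n v \<inter> perp n w) (K \<inter> (perp n v \<inter> perp n w)) \<le> ennreal (400 / L\<^sup>2)"
proof -
  let ?E = "perp n v \<inter> perp n w"
  obtain us where us: "orthonormal_basis n us ?E"
    and vol: "\<And>K. subspace_vol n ?E (K \<inter> ?E) = emeasure (lebn (length us)) {t \<in> Rn (length us). comb n us t \<in> K}"
    by (rule subspace_vol_eq_slice[OF linear_subspace_Int_perp[OF linear_subspace_perp[of n v], of w]]) blast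
  have b: "orthonormal n ((us @ [w]) @ [v])" "length ((us @ [w]) @ [v]) = n"
    using orthonormal_basis_perp_append[OF orthonormal_basis_append[OF linear_subspace_perp us w] v]
      orthonormal_basis_Rn_iff by blast+
  then have n: "n = Suc (Suc (length us))" by simp
  interpret marginal n "length us" "us @ [w, v]" "\<lambda>i. axis (if i = length us then 1 else 2) 1 :: real ^ 2"
    using b bij_betw_axis_2[of "length us"] by unfold_locales (auto simp: n)
  interpret iso: isotropic_logconcave "\<lambda>z. measure (lebn (length us)) (slice K z)" L
    by (rule isotropic_logconcave_slice[OF K])
  have cb: "convex_body n K" using K by (simp add: isotropic_def)
  have "subspace_vol n ?E (K \<inter> ?E) = ennreal (measure (lebn (length us)) (slice K 0))"
    unfolding vol slice_0[OF refl refl, symmetric]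
    using emeasure_slice_finite[OF cb, of 0] by (intro emeasure_eq_ennreal_measure) auto
  then show ?thesis
    using iso.lower_bound_0 upper_bound_real_2[OF iso.isotropic_logconcave_axioms] by (auto intro!: ennreal_leI)
qed

lemma isotropic_constant_eq:
  assumes n: "0 < n" and L: "is_isotropic_constant n K L"
  shows "isotropic_constant n K = L"
  unfolding isotropic_constant_def
proof (rule the_equality)
  fix L' assume L': "is_isotropic_constant n K L'"
  obtain v where "v \<in> unit_sphere n (Rn n)" using unit_sphere_Rn_nonempty[OF n] by blast
  then have "L'\<^sup>2 = L\<^sup>2" using L L' by (metis is_isotropic_constant_def)
  then show "L' = L" using L L' by (simp add: is_isotropic_constant_def power2_eq_iff_nonneg)
qed fact

lemma avg_section_bounds:
  obtains a b :: real where "0 < a" "0 < b"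
    "\<And>n K. 2 \<le> n \<Longrightarrow> isotropic n K \<Longrightarrow> 0 < isotropic_constant n K \<and>
      ennreal (a / isotropic_constant n K) \<le> avg_section n (Rn n) K \<and>
      avg_section n (Rn n) K \<le> ennreal (b / isotropic_constant n K) \<and>
      (\<forall>\<xi>\<in>unit_sphere n (Rn n). ennreal (a / (isotropic_constant n K)\<^sup>2) \<le> avg_section n (perp n \<xi>) K \<and>
         avg_section n (perp n \<xi>) K \<le> ennreal (b / (isotropic_constant n K)\<^sup>2))"
proof -
  define c1 where "c1 = exp (- (\<integral>x. exp (- (norm (x::real))\<^sup>2) \<partial>lborel))"
  define c2 where "c2 = exp (- 1 - (\<integral>x. exp (- (norm (x::real ^ 2))\<^sup>2) \<partial>lborel))"
  show ?thesis
  \<comment> \<open>One pair of constants serves both codimensions: the smaller lower constant and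
    the larger of 30 and 400.\<close>
  proof (rule that[of "min c1 c2" 400])
    show "0 < min c1 c2" by (simp add: c1_def c2_def)
    fix n K assume n: "2 \<le> (n::nat)" and K: "isotropic n K"
    then obtain L where L: "is_isotropic_constant n K L" by (auto simp: isotropic_def)
    have [simp]: "isotropic_constant n K = L" using n L by (intro isotropic_constant_eq) auto
    have Lpos: "0 < L" using L by (simp add: is_isotropic_constant_def)
    have mono: "ennreal (min c1 c2 / L) \<le> ennreal (c1 / L)" "ennreal (30 / L) \<le> ennreal (400 / L)"
      "ennreal (min c1 c2 / L\<^sup>2) \<le> ennreal (c2 / L\<^sup>2)"
      using Lpos by (auto intro!: ennreal_leI divide_right_mono)
    have "ennreal (min c1 c2 / L) \<le> avg_section n (Rn n) K \<and> avg_section n (Rn n) K \<le> ennreal (400 / L)"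
      unfolding avg_section_def
    proof (rule nn_integral_sphere_bounds[OF linear_subspace_Rn])
      show "unit_sphere n (Rn n) \<noteq> {}" using n by (intro unit_sphere_Rn_nonempty) simp
      fix v assume "v \<in> unit_sphere n (Rn n)"
      from hyperplane_section_bounds[OF K L this] mono
      show "ennreal (min c1 c2 / L) \<le> subspace_vol n (Rn n \<inter> perp n v) (K \<inter> Rn n \<inter> perp n v) \<and>
          subspace_vol n (Rn n \<inter> perp n v) (K \<inter> Rn n \<inter> perp n v) \<le> ennreal (400 / L)"
        unfolding Int_assoc perp_eq[symmetric] c1_def by (meson order_trans)
    qed
    moreover have "ennreal (min c1 c2 / L\<^sup>2) \<le> avg_section n (perp n v) K \<and> avg_section n (perp n v) K \<le> ennreal (400 / L\<^sup>2)"
      if v: "v \<in> unit_sphere n (Rn n)" for v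
      unfolding avg_section_def
    proof (rule nn_integral_sphere_bounds[OF linear_subspace_perp unit_sphere_perp_nonempty[OF n v]])
      fix w assume "w \<in> unit_sphere n (perp n v)"
      from codim_2_section_bounds[OF K L v this] mono
      show "ennreal (min c1 c2 / L\<^sup>2) \<le> subspace_vol n (perp n v \<inter> perp n w) (K \<inter> perp n v \<inter> perp n w) \<and>
          subspace_vol n (perp n v \<inter> perp n w) (K \<inter> perp n v \<inter> perp n w) \<le> ennreal (400 / L\<^sup>2)"
        unfolding Int_assoc c2_def by (meson order_trans)
    qed
    ultimately show "0 < isotropic_constant n K \<and>
      ennreal (min c1 c2 / isotropic_constant n K) \<le> avg_section n (Rn n) K \<and>
      avg_section n (Rn n) K \<le> ennreal (400 / isotropic_constant n K) \<and>
      (\<forall>\<xi>\<in>unit_sphere n (Rn n). ennreal (min c1 c2 / (isotropic_constant n K)\<^sup>2) \<le> avg_section n (perp n \<xi>) K \<and>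
         avg_section n (perp n \<xi>) K \<le> ennreal (400 / (isotropic_constant n K)\<^sup>2))"
      using Lpos by simp
  qed simp
qed

theorem proposition4p3:
  shows "(\<exists>a b :: real. a > 0 \<and> b > 0 \<and>
      (\<forall>n K. n \<ge> 2 \<and> isotropic n K \<longrightarrow>
        (let L = isotropic_constant n K in
          ennreal (a / L) \<le> avg_section n (Rn n) K \<and>
          avg_section n (Rn n) K \<le> ennreal (b / L) \<and>
          (\<forall>\<xi>\<in>unit_sphere n (Rn n).
             ennreal (a / L\<^sup>2) \<le> avg_section n (perp n \<xi>) K \<and>
             avg_section n (perp n \<xi>) K \<le> ennreal (b / L\<^sup>2))))) \<and>
    (\<exists>a' b' :: real. a' > 0 \<and> b' > 0 \<and>
      (\<forall>n K. n \<ge> 2 \<and> isotropic n K \<longrightarrow>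
        (let L = isotropic_constant n K;
             V = measure (lebn n) K powr (1 / real n);
             M = (SUP \<xi>\<in>unit_sphere n (Rn n). avg_section n (perp n \<xi>) K) in
          ennreal (a' * L * V) * M \<le> avg_section n (Rn n) K \<and>
          avg_section n (Rn n) K \<le> ennreal (b' * L * V) * M)))"
proof -
  obtain a b :: real where ab: "0 < a" "0 < b" and bounds:
    "\<And>n K. 2 \<le> n \<Longrightarrow> isotropic n K \<Longrightarrow> 0 < isotropic_constant n K \<and>
      ennreal (a / isotropic_constant n K) \<le> avg_section n (Rn n) K \<and>
      avg_section n (Rn n) K \<le> ennreal (b / isotropic_constant n K) \<and>
      (\<forall>\<xi>\<in>unit_sphere n (Rn n). ennreal (a / (isotropic_constant n K)\<^sup>2) \<le> avg_section n (perp n \<xi>) K \<and>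
         avg_section n (perp n \<xi>) K \<le> ennreal (b / (isotropic_constant n K)\<^sup>2))"
    using avg_section_bounds by metis
  \<comment> \<open>The average section is of order \<open>1 / L\<close> and \<open>M\<close> of
    order \<open>1 / L^2\<close>, so \<open>L * M\<close> has the right order, and the quotients of
    the earlier constants appear.\<close>
  have ratio: "ennreal (a / b * L * V) * M \<le> avg_section n (Rn n) K \<and>
      avg_section n (Rn n) K \<le> ennreal (b / a * L * V) * M"
    if n: "2 \<le> n" and K: "isotropic n K" and L: "L = isotropic_constant n K"
      and V: "V = measure (lebn n) K powr (1 / real n)"
      and M: "M = (SUP \<xi>\<in>unit_sphere n (Rn n). avg_section n (perp n \<xi>) K)" for n K L V M
  proof -
    note bd = bounds[OF n K, folded L]
    have V1: "V = 1" using K by (simp add: V isotropic_def)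
    have Lpos: "0 < L" using bd by blast
    obtain v where v: "v \<in> unit_sphere n (Rn n)" using unit_sphere_Rn_nonempty[of n] n by auto
    have "M \<le> ennreal (b / L\<^sup>2)" unfolding M using bd by (intro SUP_least) blast
    then have "ennreal (a / b * L * V) * M \<le> ennreal (a / b * L) * ennreal (b / L\<^sup>2)"
      unfolding V1 by (intro mult_mono) auto
    also have "\<dots> = ennreal (a / L)"
      using ab Lpos by (subst ennreal_mult[symmetric]) (auto simp: power2_eq_square)
    finally have 1: "ennreal (a / b * L * V) * M \<le> ennreal (a / L)" .
    have "ennreal (b / L) = ennreal (b / a * L) * ennreal (a / L\<^sup>2)"
      using ab Lpos by (subst ennreal_mult[symmetric]) (auto simp: power2_eq_square)
    also have "ennreal (a / L\<^sup>2) \<le> M" unfolding M using bd v by (intro SUP_upper2[OF v]) blast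
    finally have 2: "ennreal (b / L) \<le> ennreal (b / a * L * V) * M"
      unfolding V1 by (simp add: mult_left_mono)
    have "ennreal (a / L) \<le> avg_section n (Rn n) K" "avg_section n (Rn n) K \<le> ennreal (b / L)"
      using bd by blast+
    then show ?thesis using order_trans[OF 1] order_trans[OF _ 2] by blast
  qed
  show ?thesis
    unfolding Let_def
  proof (rule conjI)
    show "\<exists>a b. 0 < a \<and> 0 < b \<and> (\<forall>n K. 2 \<le> n \<and> isotropic n K \<longrightarrow>
          ennreal (a / isotropic_constant n K) \<le> avg_section n (Rn n) K \<and>
          avg_section n (Rn n) K \<le> ennreal (b / isotropic_constant n K) \<and>
          (\<forall>\<xi>\<in>unit_sphere n (Rn n). ennreal (a / (isotropic_constant n K)\<^sup>2) \<le> avg_section n (perp n \<xi>) K \<and>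
             avg_section n (perp n \<xi>) K \<le> ennreal (b / (isotropic_constant n K)\<^sup>2)))"
      using ab bounds by (intro exI[of _ a] exI[of _ b]) blast
    show "\<exists>a' b'. 0 < a' \<and> 0 < b' \<and> (\<forall>n K. 2 \<le> n \<and> isotropic n K \<longrightarrow>
          ennreal (a' * isotropic_constant n K * measure (lebn n) K powr (1 / real n)) *
            (SUP \<xi>\<in>unit_sphere n (Rn n). avg_section n (perp n \<xi>) K) \<le> avg_section n (Rn n) K \<and>
          avg_section n (Rn n) K \<le> ennreal (b' * isotropic_constant n K * measure (lebn n) K powr (1 / real n)) *
            (SUP \<xi>\<in>unit_sphere n (Rn n). avg_section n (perp n \<xi>) K))"
      using ab ratio by (intro exI[of _ "a / b"] exI[of _ "b / a"]) auto
  qed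
qed

end
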